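(* Let $Q>0$, let $(X,d,\mu)$ be a proper, locally $Q$-homogeneous metric measure space supporting a $Q$-Poincaré inequality, and let $(Y,d_Y)$ be an arbitrary metric space. Let $p>Q$ and let $f:X\rightarrow Y$ be a continuous mapping with an upper gradient $g\in L^p_{\mathrm{loc}}(X)$. Then $f$ is $(q,1-Q/q)$-compactly Hölder for all $q\in(Q,p)$. Moreover, if $E\subset X$ is bounded with $\dim_B E=d_E<Q$, then $$\dim_B f(E)\leq\frac{p\,d_E}{p-Q+d_E}<Q.$$
   Context: Balls are open: $B(x,r)=\{z\in X: d(x,z)<r\}$, and $\lambda B(x,r)=B(x,\lambda r)$. A metric space is proper if its closed bounded subsets are compact. A metric measure space $(X,d,\mu)$ is a separable metric space $(X,d)$ with a Borel measure $\mu$ that assigns a positive and finite value to every ball. $L^p_{\mathrm{loc}}(X)$ is the space of locally $p$-integrable real-valued functions on $X$. For a ball $B$ and $u\in L^1(B)$, $u_B=\frac{1}{\mu(B)}\int_B u\,d\mu$. Locally $Q$-homogeneous ($Q>0$): for every compact $K\subset X$ there are constants $R>0$, $C\geq1$ (depending on $K$) such that $\frac{\mu(B(x,r_2))}{\mu(B(x,r_1))}\leq C\left(\frac{r_2}{r_1}\right)^Q$ for all $x\in K$ and $0<r_1<r_2<R$. Upper gradient: a Borel function $g:X\to[0,\infty]$ is an upper gradient of a continuous map $f:X\to Y$ if for every rectifiable curve $\gamma:[0,1]\to X$, $d_Y(f(\gamma(0)),f(\gamma(1)))\leq\int_\gamma g\,ds$. Upper gradients of functions $u:X\to\mathbb{R}$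 are defined in the same way. $(X,d,\mu)$ supports a $p$-Poincaré inequality ($p>0$) if there are $C>0$ and $\lambda\geq1$ such that whenever $u:X\to\mathbb{R}$ is a function with upper gradient $g:X\to[0,\infty]$, then for every open ball $B$ in $X$ $$\frac{1}{\mu(B)}\int_B|u-u_B|\,d\mu\leq C\,\mathrm{diam}(B)\left(\frac{1}{\mu(\lambda B)}\int_{\lambda B}g^p\,d\mu\right)^{1/p}.$$ Minkowski dimension: for a bounded subset $E$ of a metric space and $r>0$, let $N(E,r)$ be the smallest number of sets of diameter at most $r$ needed to cover $E$. The (upper) Minkowski dimension of $E$ is $\dim_B E=\limsup_{r\to0}\frac{\log N(E,r)}{\log(1/r)}$. Hölder coefficient: for $\alpha\in(0,1)$ and $B\subset X$, $|f|_{\alpha,B}:=\sup\left\{\frac{d_Y(f(x),f(y))}{d(x,y)^\alpha}: x,y\in B\text{ distinct}\right\}$. Compactly Hölder mappings: for $s>1$, $\alpha\in(0,1)$, a mapping $f:X\to Y$ between metric spaces is $(s,\alpha)$-compactly Hölder if for any compact set $E\subset X$ and any $\epsilon\in(0,1)$ there are $r_E>0$ and $C_E>0$ satisfying the following: if $\{B_i\}_{i\in I}$ is an (at most countable) collection of balls $B_i=B(x_i,r)$ with $x_i\in X$ and common radius $r<r_E$ that covers $E$ and such that $B(x_i,\epsilon r)\cap B(x_j,\epsilon r)=\emptyset$ for all distinct $i,j\in I$, then $\sum_{i\in I}|f|_{\alpha,B_i}^s\leq C_E$. Here, by convention, saying that $\{B(x_i,r)\}_{i\in I}$ covers $E$ also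 entails that $B(x_i,r)\cap E\neq\emptyset$ for all $i\in I$, but the centers $x_i$ need not lie in $E$. *)

theory Defs
  imports "HOL-Analysis.Analysis"
begin

text \<open>Real powers on \<open>[0,\<infinity>]\<close>; only used with a positive exponent, where \<open>\<infinity>\<close> to the power
  \<open>a\<close> is \<open>\<infinity>\<close> and \<open>0\<close> to the power \<open>a\<close> is \<open>0\<close>.\<close>

definition ennpowr :: "ennreal \<Rightarrow> real \<Rightarrow> ennreal" where
  "ennpowr x a = (if x = \<infinity> then \<infinity> else ennreal (enn2real x powr a))"

definition metric_measure_space :: "'a::metric_space measure \<Rightarrow> bool" where
  "metric_measure_space M \<longleftrightarrow>
     separable_space (euclidean :: 'a topology) \<and> sets M = sets borel \<and>
     (\<forall>x r. 0 < r \<longrightarrow> 0 < emeasure M (ball x r) \<and> emeasure M (ball x r) < \<infinity>)"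

definition locally_homogeneous :: "real \<Rightarrow> 'a::metric_space measure \<Rightarrow> bool" where
  "locally_homogeneous Q M \<longleftrightarrow>
     (\<forall>K. compact K \<longrightarrow> (\<exists>R>0. \<exists>C\<ge>1. \<forall>x\<in>K. \<forall>r1 r2. 0 < r1 \<longrightarrow> r1 < r2 \<longrightarrow> r2 < R \<longrightarrow>
        measure M (ball x r2) / measure M (ball x r1) \<le> C * (r2 / r1) powr Q))"

text \<open>The length of \<open>\<gamma>\<close> restricted to \<open>[a,b]\<close>: supremum over all finite sequences
  \<open>t 0 \<le> \<dots> \<le> t n\<close> in \<open>[a,b]\<close>.\<close>

definition curve_length :: "(real \<Rightarrow> 'a::metric_space) \<Rightarrow> real \<Rightarrow> real \<Rightarrow> ennreal" where
  "curve_length \<gamma> a b =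
     (SUP (n, t) \<in> {(n::nat, t::nat \<Rightarrow> real). mono_on {..n} t \<and> t ` {..n} \<subseteq> {a..b}}.
        \<Sum>i<n. ennreal (dist (\<gamma> (t i)) (\<gamma> (t (Suc i)))))"

definition rectifiable_curve :: "(real \<Rightarrow> 'a::metric_space) \<Rightarrow> bool" where
  "rectifiable_curve \<gamma> \<longleftrightarrow> path \<gamma> \<and> curve_length \<gamma> 0 1 < \<infinity>"

text \<open>The arc-length parametrization of a rectifiable curve on \<open>[0,1]\<close>, defined on
  \<open>[0, length of \<gamma>]\<close>. The curve is constant on the fibres of its length function, so the
  choice of the largest parameter in the fibre is immaterial.\<close>

definition arclength_param :: "(real \<Rightarrow> 'a::metric_space) \<Rightarrow> real \<Rightarrow> 'a" where
  "arclength_param \<gamma> l = \<gamma> (Sup {t \<in> {0..1}. curve_length \<gamma> 0 t = ennreal l})"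

definition curve_integral :: "(real \<Rightarrow> 'a::metric_space) \<Rightarrow> ('a \<Rightarrow> ennreal) \<Rightarrow> ennreal" where
  "curve_integral \<gamma> g =
     (\<integral>\<^sup>+l\<in>{0..enn2real (curve_length \<gamma> 0 1)}. g (arclength_param \<gamma> l) \<partial>lborel)"

definition upper_gradient ::
  "('a::metric_space \<Rightarrow> 'b::metric_space) \<Rightarrow> ('a \<Rightarrow> ennreal) \<Rightarrow> bool" where
  "upper_gradient f g \<longleftrightarrow> g \<in> borel_measurable borel \<and>
     (\<forall>\<gamma>. rectifiable_curve \<gamma> \<longrightarrow> ennreal (dist (f (\<gamma> 0)) (f (\<gamma> 1))) \<le> curve_integral \<gamma> g)"

text \<open>Local \<open>p\<close>-integrability of a \<open>[0,\<infinity>]\<close>-valued Borel function: integrability of the \<open>p\<close>-th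
  power near every point (in a proper space: on every ball). As usual for upper gradients, the
  value \<open>\<infinity>\<close> is allowed, necessarily on a null set.\<close>

definition Lp_loc :: "real \<Rightarrow> 'a::metric_space measure \<Rightarrow> ('a \<Rightarrow> ennreal) \<Rightarrow> bool" where
  "Lp_loc p M g \<longleftrightarrow> g \<in> borel_measurable M \<and>
     (\<forall>x. \<exists>r>0. (\<integral>\<^sup>+z\<in>ball x r. ennpowr (g z) p \<partial>M) < \<infinity>)"

definition mean_value :: "'a measure \<Rightarrow> 'a set \<Rightarrow> ('a \<Rightarrow> real) \<Rightarrow> real" where
  "mean_value M B u = (LINT y:B|M. u y) / measure M B"

text \<open>The inequality is required on exactly those balls \<open>B\<close> on which \<open>u\<close> is integrable, that is,
  where the mean value of \<open>u\<close> is defined.\<close>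

definition poincare_inequality :: "real \<Rightarrow> 'a::metric_space measure \<Rightarrow> bool" where
  "poincare_inequality p M \<longleftrightarrow>
     (\<exists>C>0. \<exists>\<kappa>\<ge>1. \<forall>(u :: 'a \<Rightarrow> real) g. upper_gradient u g \<longrightarrow>
       (\<forall>x r. 0 < r \<longrightarrow> set_integrable M (ball x r) u \<longrightarrow>
          (\<integral>\<^sup>+y\<in>ball x r. ennreal \<bar>u y - mean_value M (ball x r) u\<bar> \<partial>M) / emeasure M (ball x r)
          \<le> ennreal C * ennreal (diameter (ball x r)) *
            ennpowr ((\<integral>\<^sup>+y\<in>ball x (\<kappa> * r). ennpowr (g y) p \<partial>M) / emeasure M (ball x (\<kappa> * r)))
              (1 / p)))"

text \<open>The value is \<open>\<infinity>\<close> if there is no finite cover. Boundedness is explicit because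
  \<^term>\<open>diameter\<close> is only meaningful on bounded sets.\<close>

definition covering_number :: "'a::metric_space set \<Rightarrow> real \<Rightarrow> enat" where
  "covering_number E r =
     (INF \<C> \<in> {\<C>. finite \<C> \<and> E \<subseteq> \<Union>\<C> \<and> (\<forall>S\<in>\<C>. bounded S \<and> diameter S \<le> r)}.
        enat (card \<C>))"

text \<open>Since \<^term>\<open>ln 0 = (0::real)\<close>, the empty set has Minkowski dimension \<open>0\<close>.\<close>

definition enat_ln :: "enat \<Rightarrow> ereal" where
  "enat_ln N = (case N of enat n \<Rightarrow> ereal (ln (real n)) | \<infinity> \<Rightarrow> \<infinity>)"

definition minkowski_dim :: "'a::metric_space set \<Rightarrow> ereal" where
  "minkowski_dim E =
     Limsup (at_right 0) (\<lambda>r. enat_ln (covering_number E r) / ereal (ln (1 / r)))"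

definition holder_coeff ::
  "real \<Rightarrow> 'a::metric_space set \<Rightarrow> ('a \<Rightarrow> 'b::metric_space) \<Rightarrow> ennreal" where
  "holder_coeff \<alpha> B f =
     (SUP (x, y) \<in> {(x, y). x \<in> B \<and> y \<in> B \<and> x \<noteq> y}.
        ennreal (dist (f x) (f y) / dist x y powr \<alpha>))"

text \<open>At most countable families of balls are indexed by subsets \<open>I\<close> of the natural numbers.
  The ranges \<open>s > 1\<close> and \<open>0 < \<alpha> < 1\<close> of the parameters are not built into the predicate. This
  matters only for one-point spaces, which are locally \<open>Q\<close>-homogeneous for every \<open>Q > 0\<close>: a space
  with more than one point that supports a Poincare inequality is connected, which forces
  \<open>Q \<ge> 1\<close>.\<close>

definition compactly_holder ::
  "real \<Rightarrow> real \<Rightarrow> ('a::metric_space \<Rightarrow> 'b::metric_space) \<Rightarrow> bool" where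
  "compactly_holder s \<alpha> f \<longleftrightarrow>
     (\<forall>E \<epsilon>. compact E \<longrightarrow> 0 < \<epsilon> \<longrightarrow> \<epsilon> < 1 \<longrightarrow>
       (\<exists>rE>0. \<exists>C>0. \<forall>(I :: nat set) (x :: nat \<Rightarrow> 'a) r.
          0 < r \<longrightarrow> r < rE \<longrightarrow>
          E \<subseteq> (\<Union>i\<in>I. ball (x i) r) \<longrightarrow>
          (\<forall>i\<in>I. ball (x i) r \<inter> E \<noteq> {}) \<longrightarrow>
          (\<forall>i\<in>I. \<forall>j\<in>I. i \<noteq> j \<longrightarrow> ball (x i) (\<epsilon> * r) \<inter> ball (x j) (\<epsilon> * r) = {}) \<longrightarrow>
          (\<Sum>\<^sub>\<infinity>i\<in>I. ennpowr (holder_coeff \<alpha> (ball (x i) r) f) s) \<le> ennreal C))"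

end

theory Submission
  imports Defs
begin

text \<open>Fix an exponent \<open>q\<close> with \<open>Q < q \<le> p\<close>. For a fixed point \<open>b\<close> the real function
\<open>u = dist (f \<cdot>) b\<close> inherits the upper gradient \<open>g\<close>, so the Poincare inequality applies to it, and by
comparison of power means the exponent \<open>Q\<close> on its right-hand side may be raised to \<open>q\<close>. Local
homogeneity forces \<open>\<mu>(B(x,r)) \<ge> c r\<^sup>Q\<close> uniformly over compact sets. Hence the mean oscillation of
\<open>u\<close> on \<open>B(x,r)\<close> is at most a constant times \<open>r\<close> to the power \<open>1 - Q/q\<close>, times the \<open>q\<close>-norm of \<open>g\<close>
on a concentric larger ball. The exponent \<open>1 - Q/q\<close> is positive, so the means over balls of radii
\<open>r, r/2, r/4, \<dots>\<close> telescope in a convergent geometric series (Morrey's argument). This controls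
\<open>u(x) - u(y)\<close>, and with \<open>b = f(y)\<close> it bounds the \<open>q\<close>-th power of the Hoelder coefficient of \<open>f\<close> on
\<open>B(z,r)\<close> by a constant times the integral of \<open>g\<^sup>q\<close> over \<open>B(z,5\<kappa>r)\<close>, where \<open>\<kappa>\<close> is the dilation
factor of the Poincare inequality (\<open>morrey_holder\<close>). If the balls
\<open>B(z\<^sub>i,\<epsilon>r)\<close> are disjoint, a volume count shows that the balls \<open>B(z\<^sub>i,5\<kappa>r)\<close> overlap boundedly
(\<open>sum_enlarged_balls\<close>), so the sum of these integrals is at most a multiple of the finite integral
of \<open>g\<^sup>q\<close> over a bounded set (\<open>holder_sum_bounded\<close>). This is the compact Hoelder property.

The bound on the dimension uses the same sums at the endpoint \<open>q = p\<close>. To cover \<open>f(E)\<close> by sets of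
diameter at most \<open>s\<close>, start at a radius \<open>\<rho>\<close> and give each \<open>x \<in> E\<close> the first level \<open>k\<close> for which
the image of \<open>B(x,\<rho>/2\<^sup>k)\<close> has diameter at most \<open>s\<close>. At level \<open>0\<close> one uses a maximal separated subset
of \<open>E\<close>, whose size is controlled by the covering numbers of \<open>E\<close>: it is of order at most
\<open>\<rho>\<close> to the power \<open>-d\<close> for any fixed \<open>d > dim E\<close>. A point of level \<open>k + 1\<close> is the centre of a ball
of radius \<open>\<rho>/2\<^sup>k\<close> on which \<open>f\<close> oscillates by more than \<open>s\<close>. Such a ball contributes at least
\<open>s\<^sup>p\<close> times a constant multiple of its radius to the power \<open>Q - p\<close> to the bounded Hoelder sum, so
separated points of this level number at most a constant times \<open>s\<close> to the power \<open>-p\<close> times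
\<open>\<rho>/2\<^sup>k\<close> to the power \<open>p - Q\<close> (\<open>oscillating_balls_count\<close>). These bounds form a geometric series in
\<open>k\<close> whose first term dominates (\<open>multiscale_covering\<close>). Choosing \<open>\<rho>\<close> such that \<open>\<rho>\<close> to the power
\<open>p - Q + d\<close> equals \<open>s\<^sup>p\<close> balances the two contributions; both are then of order \<open>s\<close> to the power
\<open>-pd/(p - Q + d)\<close>, and \<open>d\<close> may tend to \<open>dim E\<close>.\<close>

section \<open>Powers and power means of extended nonnegative functions\<close>

lemma ennpowr_ennreal: "0 \<le> x \<Longrightarrow> ennpowr (ennreal x) a = ennreal (x powr a)"
  by (simp add: ennpowr_def)

lemma ennpowr_mono:
  assumes "x \<le> y" "0 \<le> a"
  shows "ennpowr x a \<le> ennpowr y a"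
  using assms
  by (auto simp: ennpowr_def top_unique less_top intro!: ennreal_leI powr_mono2 enn2real_mono)

lemma borel_measurable_ennpowr [measurable]:
  assumes [measurable]: "g \<in> borel_measurable M"
  shows "(\<lambda>x. ennpowr (g x) a) \<in> borel_measurable M"
proof -
  have [measurable]: "(\<lambda>x. enn2real (g x) powr a) \<in> borel_measurable M"
    by (rule powr_real_measurable) auto
  have "{x \<in> space M. g x \<in> {\<infinity>}} \<in> sets M"
    by measurable
  then have [measurable]: "{x \<in> space M. g x = \<infinity>} \<in> sets M" by simp
  show ?thesis
    unfolding ennpowr_def by (intro measurable_If) auto
qed

text \<open>Below the threshold \<open>t\<close> the left-hand side is at most \<open>t\<^sup>a\<close>; above it, the factor \<open>x/t\<close> is at least
\<open>1\<close>, so raising its exponent from \<open>a\<close> to \<open>b\<close> can only increase it. All comparisons of \<open>L\<^sup>a\<close> and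
\<open>L\<^sup>b\<close> integrals below come from this inequality, which takes the place of Hoelder's inequality.\<close>

lemma ennpowr_truncation:
  assumes "0 < a" "a \<le> b" "0 < t"
  shows "ennpowr x a \<le> ennreal (t powr a) + ennreal (t powr (a - b)) * ennpowr x b"
proof (cases x)
  case top
  then show ?thesis
    using assms by (simp add: ennpowr_def ennreal_mult_top)
next
  case (real r)
  have "r powr a \<le> t powr a + t powr (a - b) * r powr b"
  proof (cases "r \<le> t")
    case True
    then have "r powr a \<le> t powr a"
      using assms real by (intro powr_mono2) auto
    then show ?thesis
      by (simp add: add_increasing2)
  next
    case False
    then have "r powr a = r powr (a - b) * r powr b"
      using assms by (simp add: powr_add[symmetric])
    also have "\<dots> \<le> t powr (a - b) * r powr b"
      using assms False by (intro mult_right_mono powr_mono2') auto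
    finally show ?thesis
      by (simp add: add_increasing)
  qed
  then show ?thesis
    using real by (simp add: ennpowr_ennreal ennreal_mult[symmetric] ennreal_plus[symmetric]
        ennreal_leI del: ennreal_plus)
qed

text \<open>This is the monotonicity of power means, with a harmless factor \<open>2\<close>: truncation at the level \<open>t\<close>
that bounds the mean of order \<open>b\<close> makes both terms of the truncated integrand contribute at most
\<open>t\<^sup>a\<close> on average.\<close>

lemma nn_integral_power_mean:
  assumes g: "g \<in> borel_measurable M" and A: "A \<in> sets M"
    and "0 < a" "a \<le> b" "0 < t"
    and le: "(\<integral>\<^sup>+y\<in>A. ennpowr (g y) b \<partial>M) \<le> ennreal (t powr b) * emeasure M A"
  shows "(\<integral>\<^sup>+y\<in>A. ennpowr (g y) a \<partial>M) \<le> ennreal (2 * t powr a) * emeasure M A"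
proof -
  note [measurable] = g A
  have "(\<integral>\<^sup>+y\<in>A. ennpowr (g y) a \<partial>M)
      \<le> (\<integral>\<^sup>+y. ennreal (t powr a) * indicator A y
            + ennreal (t powr (a - b)) * (ennpowr (g y) b * indicator A y) \<partial>M)"
    using ennpowr_truncation[OF assms(3-5)]
    by (intro nn_integral_mono) (auto simp: indicator_def)
  also have "\<dots> = ennreal (t powr a) * emeasure M A
      + ennreal (t powr (a - b)) * (\<integral>\<^sup>+y\<in>A. ennpowr (g y) b \<partial>M)"
    by (simp add: nn_integral_add nn_integral_cmult nn_integral_cmult_indicator)
  also have "\<dots> \<le> ennreal (t powr a) * emeasure M A
      + ennreal (t powr (a - b)) * (ennreal (t powr b) * emeasure M A)"
    using le by (intro add_left_mono mult_left_mono) auto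
  also have "ennreal (t powr (a - b)) * (ennreal (t powr b) * emeasure M A)
      = ennreal (t powr a) * emeasure M A"
    using \<open>0 < t\<close> by (simp add: mult.assoc[symmetric] ennreal_mult[symmetric] powr_add[symmetric])
  also have "ennreal (t powr a) * emeasure M A + ennreal (t powr a) * emeasure M A
      = ennreal (2 * t powr a) * emeasure M A"
    by (simp only: distrib_right[symmetric] ennreal_plus[symmetric] powr_ge_zero mult_2)
  finally show ?thesis .
qed

section \<open>Local integrability on bounded sets\<close>

lemma continuous_set_integrable_ball:
  fixes M :: "'a::metric_space measure" and u :: "'a \<Rightarrow> real"
  assumes mms: "metric_measure_space M"
    and proper: "\<forall>S :: 'a set. closed S \<and> bounded S \<longrightarrow> compact S"
    and u: "continuous_on UNIV u"
  shows "set_integrable M (ball x r) u"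
proof (cases "0 < r")
  case False
  then have "ball x r = {}" by simp
  then show ?thesis by (simp only: set_integrable_empty)
next
  case True
  have sets: "sets M = sets borel" and fin: "emeasure M (ball x r) < \<infinity>"
    using mms True by (auto simp: metric_measure_space_def)
  have "compact (u ` cball x r)"
    using proper by (intro compact_continuous_image continuous_on_subset[OF u]) auto
  then obtain b where b: "\<And>y. y \<in> cball x r \<Longrightarrow> \<bar>u y\<bar> \<le> b"
    using compact_imp_bounded by (force simp: bounded_iff)
  have meas: "u \<in> borel_measurable M"
    using borel_measurable_continuous_onI[OF u] sets by (simp cong: measurable_cong_sets)
  show ?thesis
  proof (rule set_integrable_bound)
    show "set_integrable M (ball x r) (\<lambda>y. b)"
      using fin sets by (auto simp: set_integrable_def)
    show "set_borel_measurable M (ball x r) u"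
      unfolding set_borel_measurable_def using meas sets
      by (intro borel_measurable_scaleR borel_measurable_indicator) auto
    have "\<bar>u y\<bar> \<le> \<bar>b\<bar>" if "y \<in> ball x r" for y
      using b[of y] that by auto
    then show "AE y in M. y \<in> ball x r \<longrightarrow> norm (u y) \<le> norm b"
      by simp
  qed
qed

lemma Lp_loc_compact:
  fixes M :: "'a::metric_space measure"
  assumes g: "Lp_loc p M g" and sets: "sets M = sets borel" and K: "compact K"
  shows "(\<integral>\<^sup>+y\<in>K. ennpowr (g y) p \<partial>M) < \<infinity>"
proof -
  from g obtain r where r: "\<And>x. 0 < r x" "\<And>x. (\<integral>\<^sup>+y\<in>ball x (r x). ennpowr (g y) p \<partial>M) < \<infinity>"
    unfolding Lp_loc_def by metis
  have [measurable]: "g \<in> borel_measurable M" using g by (simp add: Lp_loc_def)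
  have [measurable]: "ball x s \<in> sets M" for x s using sets by simp
  have "K \<subseteq> (\<Union>x\<in>K. ball x (r x))" using r by auto
  then obtain D where D: "D \<subseteq> K" "finite D" "K \<subseteq> (\<Union>x\<in>D. ball x (r x))"
    by (rule compactE_image[OF K, rotated]) auto
  have "(\<integral>\<^sup>+y\<in>K. ennpowr (g y) p \<partial>M)
      \<le> (\<integral>\<^sup>+y. (\<Sum>x\<in>D. ennpowr (g y) p * indicator (ball x (r x)) y) \<partial>M)"
  proof (rule nn_integral_mono)
    fix y
    show "ennpowr (g y) p * indicator K y \<le> (\<Sum>x\<in>D. ennpowr (g y) p * indicator (ball x (r x)) y)"
    proof (cases "y \<in> K")
      case True
      then obtain x where x: "x \<in> D" "y \<in> ball x (r x)" using D by auto
      then have "ennpowr (g y) p * indicator K y = ennpowr (g y) p * indicator (ball x (r x)) y"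
        using True by simp
      also have "\<dots> \<le> (\<Sum>x\<in>D. ennpowr (g y) p * indicator (ball x (r x)) y)"
        using x D by (intro member_le_sum) auto
      finally show ?thesis .
    qed simp
  qed
  also have "\<dots> = (\<Sum>x\<in>D. \<integral>\<^sup>+y\<in>ball x (r x). ennpowr (g y) p \<partial>M)"
    by (intro nn_integral_sum) measurable
  also have "\<dots> < \<infinity>" using r D by (simp add: less_top)
  finally show ?thesis .
qed

lemma ennpowr_integral_finite_lower_exponent:
  assumes g: "g \<in> borel_measurable M" and K: "K \<in> fmeasurable M" and "0 < q" "q \<le> p"
    and fin: "(\<integral>\<^sup>+y\<in>K. ennpowr (g y) p \<partial>M) < \<infinity>"
  shows "(\<integral>\<^sup>+y\<in>K. ennpowr (g y) q \<partial>M) < \<infinity>"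
proof -
  note [measurable] = g fmeasurableD[OF K]
  have "(\<integral>\<^sup>+y\<in>K. ennpowr (g y) q \<partial>M) \<le> (\<integral>\<^sup>+y. indicator K y + ennpowr (g y) p * indicator K y \<partial>M)"
    using ennpowr_truncation[OF assms(3,4) zero_less_one]
    by (intro nn_integral_mono) (auto simp: indicator_def)
  also have "\<dots> = emeasure M K + (\<integral>\<^sup>+y\<in>K. ennpowr (g y) p \<partial>M)"
    by (subst nn_integral_add) auto
  also have "\<dots> < \<infinity>" using fin K by (auto simp: fmeasurable_def)
  finally show ?thesis .
qed

section \<open>The Poincare inequality as a bound on mean oscillations\<close>

lemma diameter_le_dist:
  assumes "0 \<le> d" "\<And>x y. x \<in> S \<Longrightarrow> y \<in> S \<Longrightarrow> dist x y \<le> d"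
  shows "diameter S \<le> d"
  using assms by (auto simp: diameter_def intro!: cSUP_least)

text \<open>The Poincare inequality with its right-hand side in a form that avoids quotients and roots in
\<open>[0,\<infinity>]\<close>: instead of the \<open>q\<close>-mean of \<open>g\<close> over the dilated ball, it uses any positive real upper bound
\<open>t\<close> for this mean.\<close>

definition oscillation_controlled ::
  "'a::metric_space measure \<Rightarrow> real \<Rightarrow> ('a \<Rightarrow> ennreal) \<Rightarrow> real \<Rightarrow> real \<Rightarrow> bool" where
  "oscillation_controlled M q g C \<kappa> \<longleftrightarrow>
     (\<forall>(u :: 'a \<Rightarrow> real) t x r. upper_gradient u g \<longrightarrow> 0 < t \<longrightarrow> 0 < r \<longrightarrow> set_integrable M (ball x r) u \<longrightarrow>
       (\<integral>\<^sup>+y\<in>ball x (\<kappa> * r). ennpowr (g y) q \<partial>M)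
         \<le> ennreal (t powr q) * emeasure M (ball x (\<kappa> * r)) \<longrightarrow>
       (LINT y:ball x r|M. \<bar>u y - mean_value M (ball x r) u\<bar>) \<le> C * r * t * measure M (ball x r))"

text \<open>Raising the exponent from \<open>Q\<close> to \<open>q\<close> is what makes Morrey's argument possible, because the resulting
Hoelder exponent \<open>1 - Q/q\<close> vanishes at \<open>q = Q\<close>. The constants depend on neither \<open>q\<close> nor \<open>g\<close>.\<close>

lemma poincare_oscillation:
  fixes M :: "'a::metric_space measure"
  assumes "poincare_inequality Q M" "0 < Q" "metric_measure_space M"
  obtains C \<kappa> where "C > 0" "\<kappa> \<ge> 1"
    "\<And>q g. Q \<le> q \<Longrightarrow> oscillation_controlled M q g C \<kappa>"
proof -
  from assms obtain C \<kappa> where C: "C > 0" and \<kappa>: "\<kappa> \<ge> 1"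
    and P: "\<And>(u :: 'a \<Rightarrow> real) g x r. upper_gradient u g \<Longrightarrow> 0 < r \<Longrightarrow> set_integrable M (ball x r) u \<Longrightarrow>
          (\<integral>\<^sup>+y\<in>ball x r. ennreal \<bar>u y - mean_value M (ball x r) u\<bar> \<partial>M) / emeasure M (ball x r)
          \<le> ennreal C * ennreal (diameter (ball x r)) *
            ennpowr ((\<integral>\<^sup>+y\<in>ball x (\<kappa> * r). ennpowr (g y) Q \<partial>M) / emeasure M (ball x (\<kappa> * r)))
              (1 / Q)"
    unfolding poincare_inequality_def by blast
  have sets: "sets M = sets borel"
    and ball: "\<And>x r. 0 < r \<Longrightarrow> 0 < emeasure M (ball x r) \<and> emeasure M (ball x r) < \<infinity>"
    using assms(3) by (auto simp: metric_measure_space_def)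
  show thesis
  \<comment> \<open>One factor \<open>2\<close> bounds the diameter by the radius, the other comes from the power mean comparison.\<close>
  proof (rule that[of "2 * C * 2 powr (1 / Q)" \<kappa>])
    show "2 * C * 2 powr (1 / Q) > 0" "\<kappa> \<ge> 1" using C \<kappa> by auto
    show "oscillation_controlled M q g (2 * C * 2 powr (1 / Q)) \<kappa>" if q: "Q \<le> q" for q g
      unfolding oscillation_controlled_def
    proof (intro allI impI)
      fix u :: "'a \<Rightarrow> real" and t x r
      assume ug: "upper_gradient u g" and t: "0 < t" and r: "0 < r"
        and int: "set_integrable M (ball x r) u"
        and le: "(\<integral>\<^sup>+y\<in>ball x (\<kappa> * r). ennpowr (g y) q \<partial>M) \<le> ennreal (t powr q) * emeasure M (ball x (\<kappa> * r))"
      let ?m = "mean_value M (ball x r) u"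
      have g: "g \<in> borel_measurable M"
        using ug sets by (simp add: upper_gradient_def cong: measurable_cong_sets)
      have \<kappa>r: "0 < \<kappa> * r" using \<kappa> r by simp
      note b = ball[OF r, of x] and kb = ball[OF \<kappa>r, of x]
      have meas: "ball x s \<in> sets M" for s using sets by simp
      have "(\<integral>\<^sup>+y\<in>ball x (\<kappa> * r). ennpowr (g y) Q \<partial>M) \<le> ennreal (2 * t powr Q) * emeasure M (ball x (\<kappa> * r))"
        using g meas \<open>0 < Q\<close> q t le by (rule nn_integral_power_mean)
      then have "(\<integral>\<^sup>+y\<in>ball x (\<kappa> * r). ennpowr (g y) Q \<partial>M) / emeasure M (ball x (\<kappa> * r))
          \<le> ennreal (2 * t powr Q) * emeasure M (ball x (\<kappa> * r)) / emeasure M (ball x (\<kappa> * r))"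
        by (rule divide_right_mono_ennreal)
      also have "\<dots> = ennreal (2 * t powr Q)"
        using kb by (intro ennreal_mult_divide_eq) auto
      finally have "ennpowr ((\<integral>\<^sup>+y\<in>ball x (\<kappa> * r). ennpowr (g y) Q \<partial>M) / emeasure M (ball x (\<kappa> * r))) (1 / Q)
          \<le> ennpowr (ennreal (2 * t powr Q)) (1 / Q)"
        using \<open>0 < Q\<close> by (intro ennpowr_mono) auto
      also have "\<dots> = ennreal (2 powr (1 / Q) * t)"
        using \<open>0 < Q\<close> t by (simp add: ennpowr_ennreal powr_mult powr_powr)
      finally have avg: "ennpowr ((\<integral>\<^sup>+y\<in>ball x (\<kappa> * r). ennpowr (g y) Q \<partial>M) / emeasure M (ball x (\<kappa> * r))) (1 / Q)
          \<le> ennreal (2 powr (1 / Q) * t)" .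
      have diam: "diameter (ball x r) \<le> 2 * r"
      proof (rule diameter_le_dist)
        fix y z assume "y \<in> ball x r" "z \<in> ball x r"
        then show "dist y z \<le> 2 * r" using dist_triangle3[of y z x] by simp
      qed (use r in simp)
      have "set_integrable M (ball x r) (\<lambda>y. ?m)"
        using b by (auto simp: set_integrable_def meas)
      with int have int': "set_integrable M (ball x r) (\<lambda>y. \<bar>u y - ?m\<bar>)"
        by (intro set_integrable_abs set_integral_diff)
      have "(\<integral>\<^sup>+y\<in>ball x r. ennreal \<bar>u y - ?m\<bar> \<partial>M)
          = (\<integral>\<^sup>+y. ennreal (indicator (ball x r) y *\<^sub>R \<bar>u y - ?m\<bar>) \<partial>M)"
        by (intro nn_integral_cong) (auto simp: indicator_def)
      also have "\<dots> = ennreal (LINT y:ball x r|M. \<bar>u y - ?m\<bar>)"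
        unfolding set_lebesgue_integral_def
        using int' by (intro nn_integral_eq_integral) (auto simp: set_integrable_def)
      finally have eq: "(\<integral>\<^sup>+y\<in>ball x r. ennreal \<bar>u y - ?m\<bar> \<partial>M) = ennreal (LINT y:ball x r|M. \<bar>u y - ?m\<bar>)" .
      have fin: "emeasure M (ball x r) = ennreal (measure M (ball x r))"
        using b by (intro emeasure_eq_ennreal_measure) auto
      have pos: "measure M (ball x r) > 0"
        using b unfolding fin by simp
      have nonneg: "0 \<le> (LINT y:ball x r|M. \<bar>u y - ?m\<bar>)"
        unfolding set_lebesgue_integral_def by (intro Bochner_Integration.integral_nonneg) simp
      have "ennreal ((LINT y:ball x r|M. \<bar>u y - ?m\<bar>) / measure M (ball x r))
          \<le> ennreal C * ennreal (diameter (ball x r)) *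
              ennpowr ((\<integral>\<^sup>+y\<in>ball x (\<kappa> * r). ennpowr (g y) Q \<partial>M) / emeasure M (ball x (\<kappa> * r))) (1 / Q)"
        using P[OF ug r int] unfolding eq fin using nonneg pos by (simp add: divide_ennreal)
      also have "\<dots> \<le> ennreal C * ennreal (2 * r) * ennreal (2 powr (1 / Q) * t)"
        using diam avg by (intro mult_mono ennreal_leI) auto
      also have "\<dots> = ennreal (2 * C * 2 powr (1 / Q) * r * t)"
        using C r t by (simp add: ennreal_mult[symmetric] mult_ac)
      finally have "(LINT y:ball x r|M. \<bar>u y - ?m\<bar>) / measure M (ball x r) \<le> 2 * C * 2 powr (1 / Q) * r * t"
        using C r t by (subst (asm) ennreal_le_iff) auto
      then show "(LINT y:ball x r|M. \<bar>u y - ?m\<bar>) \<le> 2 * C * 2 powr (1 / Q) * r * t * measure M (ball x r)"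
        using pos by (simp add: pos_divide_le_eq)
    qed
  qed
qed

text \<open>Applied with \<open>a\<close> the mean over the larger set \<open>B\<close>, this compares the means over nested balls; applied
with \<open>A = B\<close> and \<open>a\<close> the value at the centre, it gives convergence of the means.\<close>

lemma mean_value_deviation:
  fixes u :: "'a \<Rightarrow> real"
  assumes A: "A \<in> sets M" and B: "B \<in> sets M" "A \<subseteq> B" "emeasure M B < \<infinity>"
    and pos: "0 < measure M A" and u: "set_integrable M B u"
  shows "\<bar>mean_value M A u - a\<bar> \<le> (LINT y:B|M. \<bar>u y - a\<bar>) / measure M A"
proof -
  have "emeasure M A < \<infinity>"
    using emeasure_mono[OF B(2,1)] B(3) by (rule le_less_trans)
  then have ca: "set_integrable M A (\<lambda>y. a)" and cb: "set_integrable M B (\<lambda>y. a)"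
    using A B by (auto simp: set_integrable_def)
  have ua: "set_integrable M A u"
    using u A B by (intro set_integrable_subset[OF u]) auto
  have "(LINT y:A|M. u y - a) = (LINT y:A|M. u y) - measure M A * a"
    using A ua ca \<open>emeasure M A < \<infinity>\<close> by (subst set_integral_diff) (auto simp: set_integral_const)
  then have "mean_value M A u - a = (LINT y:A|M. u y - a) / measure M A"
    using pos by (simp add: mean_value_def field_simps)
  then have "\<bar>mean_value M A u - a\<bar> = \<bar>LINT y:A|M. u y - a\<bar> / measure M A"
    using pos by simp
  also have "\<bar>LINT y:A|M. u y - a\<bar> \<le> (LINT y:A|M. \<bar>u y - a\<bar>)"
    using set_integral_norm_bound[OF set_integral_diff(1)[OF ua ca]] by simp
  also have "\<dots> \<le> (LINT y:B|M. \<bar>u y - a\<bar>)"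
    unfolding set_lebesgue_integral_def
  proof (rule Bochner_Integration.integral_mono)
    show "integrable M (\<lambda>y. indicator A y *\<^sub>R \<bar>u y - a\<bar>)"
      "integrable M (\<lambda>y. indicator B y *\<^sub>R \<bar>u y - a\<bar>)"
      using set_integrable_abs[OF set_integral_diff(1)[OF ua ca]]
        set_integrable_abs[OF set_integral_diff(1)[OF u cb]]
      by (simp_all add: set_integrable_def)
  qed (use B in \<open>auto simp: indicator_def\<close>)
  finally show ?thesis
    using pos by (simp add: divide_right_mono)
qed

section \<open>Ball masses over a compact set\<close>

text \<open>The quantitative geometry of the space over a region \<open>K\<close> below a fixed scale \<open>R\<close>. The two growth
conditions only concern centres in \<open>K\<close>, while the balls themselves may leave \<open>K\<close>.\<close>

locale homogeneous_region =
  fixes M :: "'a::metric_space measure" and K :: "'a set" and Q Ch c R :: real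
  assumes sets_eq: "sets M = sets borel"
    and ball_mass: "0 < r \<Longrightarrow> 0 < emeasure M (ball x r) \<and> emeasure M (ball x r) < \<infinity>"
    and Q_pos: "0 < Q" and Ch_ge: "1 \<le> Ch" and c_pos: "0 < c" and R_pos: "0 < R"
    and homogeneous: "x \<in> K \<Longrightarrow> 0 < r1 \<Longrightarrow> r1 < r2 \<Longrightarrow> r2 < R \<Longrightarrow>
      measure M (ball x r2) \<le> Ch * (r2 / r1) powr Q * measure M (ball x r1)"
    and lower_mass: "x \<in> K \<Longrightarrow> 0 < r \<Longrightarrow> r < R \<Longrightarrow> c * r powr Q \<le> measure M (ball x r)"

text \<open>The lower mass bound comes from homogeneity between the radius \<open>r\<close> and one fixed radius \<open>s\<close>: the
masses of the balls of radius \<open>s\<close> centred in \<open>K\<close> have a positive lower bound, since each of them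
contains one of finitely many balls of radius \<open>s/2\<close> that cover \<open>K\<close>.\<close>

lemma homogeneous_region_exists:
  fixes M :: "'a::metric_space measure"
  assumes "0 < Q" and mms: "metric_measure_space M" and hom: "locally_homogeneous Q M"
    and K: "compact K"
  obtains Ch c R where "homogeneous_region M K Q Ch c R"
proof -
  have sets: "sets M = sets borel"
    and mass: "\<And>x r. 0 < r \<Longrightarrow> 0 < emeasure M (ball x r) \<and> emeasure M (ball x r) < \<infinity>"
    using mms by (auto simp: metric_measure_space_def)
  have pos: "0 < measure M (ball x r)" if "0 < r" for x r
    using mass[OF that, of x] by (simp add: measure_def enn2real_positive_iff)
  obtain R0 Ch where R0: "R0 > 0" and Ch: "Ch \<ge> 1"
    and H: "\<And>x r1 r2. x \<in> K \<Longrightarrow> 0 < r1 \<Longrightarrow> r1 < r2 \<Longrightarrow> r2 < R0 \<Longrightarrow>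
        measure M (ball x r2) / measure M (ball x r1) \<le> Ch * (r2 / r1) powr Q"
    using hom K unfolding locally_homogeneous_def by meson
  have hom': "measure M (ball x r2) \<le> Ch * (r2 / r1) powr Q * measure M (ball x r1)"
    if "x \<in> K" "0 < r1" "r1 < r2" "r2 < R0" for x r1 r2
    using H[OF that] pos[OF that(2), of x] by (simp add: pos_divide_le_eq)
  define s where "s = R0 / 2"
  have s: "0 < s" "s < R0" using R0 by (auto simp: s_def)
  have "K \<subseteq> (\<Union>y\<in>K. ball y (s / 2))" using s by auto
  then obtain D where D: "D \<subseteq> K" "finite D" "K \<subseteq> (\<Union>y\<in>D. ball y (s / 2))"
    by (rule compactE_image[OF K, rotated]) auto
  define m where "m = Min (insert 1 ((\<lambda>y. measure M (ball y (s / 2))) ` D))"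
  have "0 < m" using D(2) pos s by (auto simp: m_def)
  have m: "m \<le> measure M (ball x s)" if x: "x \<in> K" for x
  proof -
    obtain y where y: "y \<in> D" "x \<in> ball y (s / 2)" using D(3) x by auto
    have "m \<le> measure M (ball y (s / 2))" using y D(2) by (auto simp: m_def)
    also have "\<dots> \<le> measure M (ball x s)"
    proof (rule measure_mono_fmeasurable)
      show "ball y (s / 2) \<subseteq> ball x s"
      proof
        fix w assume "w \<in> ball y (s / 2)"
        then show "w \<in> ball x s" using y(2) dist_triangle2[of x w y] by (simp add: dist_commute)
      qed
      show "ball x s \<in> fmeasurable M" using mass[OF s(1), of x] sets by (auto simp: fmeasurable_def)
    qed (simp add: sets)
    finally show ?thesis .
  qed
  have "homogeneous_region M K Q Ch (m / (Ch * s powr Q)) s"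
  proof
    show "m / (Ch * s powr Q) * r powr Q \<le> measure M (ball x r)" if x: "x \<in> K" and r: "0 < r" "r < s" for x r
    proof -
      have "m \<le> Ch * (s / r) powr Q * measure M (ball x r)"
        using m[OF x] hom'[OF x r s(2)] by linarith
      then show ?thesis
        using Ch s r by (simp add: powr_divide field_simps)
    qed
  qed (use sets mass assms Ch s \<open>0 < m\<close> hom' in auto)
  then show thesis by (rule that)
qed

context homogeneous_region
begin

lemma ball_sets [measurable]: "ball x r \<in> sets M"
  by (simp add: sets_eq)

lemma ball_fmeasurable: "ball x r \<in> fmeasurable M"
  using ball_mass[of r x] by (cases "0 < r") (auto simp: fmeasurable_def sets_eq not_less ball_empty)

lemma ball_pos: "0 < r \<Longrightarrow> 0 < measure M (ball x r)"
  using ball_mass[of r x] by (simp add: measure_def enn2real_positive_iff)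

section \<open>From mean oscillations to pointwise differences\<close>

text \<open>When the radius is halved, the mean changes by at most the doubling constant times the mean
oscillation, that is, by a multiple of \<open>r\<close> to the power \<open>\<alpha>\<close>. These changes are summable, and the
means converge to \<open>u x\<close> by continuity.\<close>

lemma mean_value_to_centre:
  assumes x: "x \<in> K" and \<rho>: "0 < \<rho>" "\<rho> < R" and u: "isCont u x" and \<alpha>: "0 < \<alpha>" and H: "0 \<le> H"
    and int: "\<And>r. 0 < r \<Longrightarrow> r \<le> \<rho> \<Longrightarrow> set_integrable M (ball x r) u"
    and osc: "\<And>r. 0 < r \<Longrightarrow> r \<le> \<rho> \<Longrightarrow>
      (LINT y:ball x r|M. \<bar>u y - mean_value M (ball x r) u\<bar>) \<le> H * r powr \<alpha> * measure M (ball x r)"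
  shows "\<bar>mean_value M (ball x \<rho>) u - u x\<bar> \<le> Ch * 2 powr Q / (1 - 2 powr (-\<alpha>)) * H * \<rho> powr \<alpha>"
proof -
  define r where "r k = \<rho> / 2 ^ k" for k
  define m where "m k = mean_value M (ball x (r k)) u" for k
  define \<beta> where "\<beta> = 2 powr (-\<alpha>)"
  define E where "E = Ch * 2 powr Q * H * \<rho> powr \<alpha>"
  have r: "0 < r k" "r k \<le> \<rho>" "r k < R" "r (Suc k) = r k / 2" for k
  proof -
    have "\<rho> * 1 \<le> \<rho> * 2 ^ k" using \<rho> by (intro mult_left_mono) auto
    then show le: "r k \<le> \<rho>" by (simp add: r_def divide_le_eq)
    show "0 < r k" "r k < R" "r (Suc k) = r k / 2" using \<rho> le by (auto simp: r_def)
  qed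
  have \<beta>: "0 < \<beta>" "\<beta> < 1"
    using \<alpha> by (auto simp: \<beta>_def powr_less_one)
  have E: "0 \<le> E" using Ch_ge H by (simp add: E_def)
  have rk: "r k powr \<alpha> = \<rho> powr \<alpha> * \<beta> ^ k" for k
    using \<rho> by (simp add: r_def \<beta>_def powr_divide powr_minus_divide powr_realpow[symmetric]
        powr_powr power_one_over[symmetric] mult.commute power_divide)
  have step: "\<bar>m (Suc k) - m k\<bar> \<le> E * \<beta> ^ k" for k
  proof -
    let ?A = "ball x (r (Suc k))" and ?B = "ball x (r k)"
    have pos: "0 < measure M ?A" by (simp add: ball_pos r)
    have "\<bar>m (Suc k) - m k\<bar> \<le> (LINT y:?B|M. \<bar>u y - m k\<bar>) / measure M ?A"
      unfolding m_def using r[of k] \<rho> ball_mass[of "r k" x] int[of "r k"] pos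
      by (intro mean_value_deviation) (auto simp: ball_sets)
    also have "\<dots> \<le> (H * r k powr \<alpha> * measure M ?B) / measure M ?A"
      using osc[of "r k"] r[of k] pos by (intro divide_right_mono) (auto simp: m_def)
    also have "\<dots> \<le> (H * r k powr \<alpha> * (Ch * 2 powr Q * measure M ?A)) / measure M ?A"
    proof (intro divide_right_mono mult_left_mono)
      have "r k / r (Suc k) = 2" "r (Suc k) < r k" using r(1)[of k] by (simp_all add: r(4))
      then show "measure M ?B \<le> Ch * 2 powr Q * measure M ?A"
        using homogeneous[OF x, of "r (Suc k)" "r k"] r(1)[of "Suc k"] r(3)[of k] by simp
    qed (use pos H in auto)
    also have "\<dots> = E * \<beta> ^ k"
      using pos by (simp add: rk E_def)
    finally show ?thesis .
  qed
  have tele: "\<bar>m 0 - m n\<bar> \<le> E / (1 - \<beta>)" for n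
  proof -
    have "\<bar>m 0 - m n\<bar> \<le> (\<Sum>k<n. E * \<beta> ^ k)"
    proof (induction n)
      case (Suc n)
      then show ?case using step[of n] by simp
    qed simp
    also have "\<dots> = E * ((1 - \<beta> ^ n) / (1 - \<beta>))"
      using \<beta> by (simp add: sum_distrib_left[symmetric] sum_gp_strict)
    also have "\<dots> \<le> E * (1 / (1 - \<beta>))"
      using \<beta> E by (intro mult_left_mono divide_right_mono) auto
    finally show ?thesis by simp
  qed
  have lim: "m \<longlonglongrightarrow> u x"
  proof (rule metric_LIMSEQ_I)
    fix e :: real assume e: "0 < e"
    obtain d where d: "d > 0" "\<And>y. dist y x < d \<Longrightarrow> dist (u y) (u x) < e / 2"
      using u e unfolding continuous_at_eps_delta by (metis half_gt_zero)
    have "r \<longlonglongrightarrow> 0"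
      unfolding r_def by (rule LIMSEQ_divide_realpow_zero) simp
    then obtain N where N: "\<And>n. n \<ge> N \<Longrightarrow> r n < d"
      using d(1) r(1) by (metis (no_types, lifting) LIMSEQ_iff diff_zero real_norm_def abs_of_pos)
    show "\<exists>N. \<forall>n\<ge>N. dist (m n) (u x) < e"
    proof (intro exI allI impI)
      fix n assume n: "N \<le> n"
      let ?A = "ball x (r n)"
      have pos: "0 < measure M ?A" by (simp add: ball_pos r)
      have i: "set_integrable M ?A u" using int r by auto
      have ci: "set_integrable M ?A (\<lambda>y. b)" for b :: real
        using ball_mass[of "r n" x] r[of n] by (auto simp: set_integrable_def ball_sets)
      have "\<bar>m n - u x\<bar> \<le> (LINT y:?A|M. \<bar>u y - u x\<bar>) / measure M ?A"
        unfolding m_def using ball_mass[of "r n" x] r[of n] pos i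
        by (intro mean_value_deviation) (auto simp: ball_sets)
      also have "\<dots> \<le> (LINT y:?A|M. e / 2) / measure M ?A"
      proof (intro divide_right_mono set_integral_mono)
        show "set_integrable M ?A (\<lambda>y. \<bar>u y - u x\<bar>)"
          by (intro set_integrable_abs set_integral_diff i ci)
        fix y assume "y \<in> ?A"
        then show "\<bar>u y - u x\<bar> \<le> e / 2"
          using d(2)[of y] N[OF n] by (simp add: dist_commute[of x] dist_real_def)
      qed (use pos ci in auto)
      also have "\<dots> = e / 2"
        using pos ball_mass[of "r n" x] r[of n]
        by (simp add: set_integral_const ball_sets less_top)
      finally show "dist (m n) (u x) < e" using e by (simp add: dist_real_def)
    qed
  qed
  have "(\<lambda>n. \<bar>m 0 - m n\<bar>) \<longlonglongrightarrow> \<bar>m 0 - u x\<bar>"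
    by (intro tendsto_intros lim)
  then have "\<bar>m 0 - u x\<bar> \<le> E / (1 - \<beta>)"
    using tele by (intro LIMSEQ_le_const2) auto
  then show ?thesis
    by (simp add: m_def r_def E_def \<beta>_def mult_ac)
qed

lemma ball_in_triple:
  assumes "dist x y = d" "0 < d" "y \<in> K" "3 * d < R"
  shows "measure M (ball x (2 * d)) \<le> Ch * 3 powr Q * measure M (ball y d)"
proof -
  have "ball x (2 * d) \<subseteq> ball y (3 * d)"
  proof
    fix w assume "w \<in> ball x (2 * d)"
    then show "w \<in> ball y (3 * d)" using assms(1) dist_triangle[of y w x] by (simp add: dist_commute)
  qed
  then have "measure M (ball x (2 * d)) \<le> measure M (ball y (3 * d))"
    by (intro measure_mono_fmeasurable) (auto simp: ball_sets ball_fmeasurable)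
  also have "\<dots> \<le> Ch * (3 * d / d) powr Q * measure M (ball y d)"
    using assms by (intro homogeneous) auto
  finally show ?thesis using assms by simp
qed

text \<open>With \<open>d\<close> the distance of the points, \<open>u x\<close> is compared with the mean over \<open>ball x (2 * d)\<close> and
\<open>u y\<close> with the mean over \<open>ball y d\<close>; the second ball lies in the first and has comparable mass.\<close>

lemma two_point_estimate:
  assumes xy: "x \<in> K" "y \<in> K" "x \<noteq> y" "3 * dist x y < R"
    and u: "isCont u x" "isCont u y" and \<alpha>: "0 < \<alpha>" and H: "0 \<le> H"
    and int: "\<And>z r. 0 < r \<Longrightarrow> set_integrable M (ball z r) u"
    and osc: "\<And>z r. z \<in> {x, y} \<Longrightarrow> 0 < r \<Longrightarrow> r \<le> 2 * dist x y \<Longrightarrow>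
      (LINT w:ball z r|M. \<bar>u w - mean_value M (ball z r) u\<bar>) \<le> H * r powr \<alpha> * measure M (ball z r)"
  shows "\<bar>u x - u y\<bar> \<le> (Ch * 2 powr Q / (1 - 2 powr (-\<alpha>)) * (2 powr \<alpha> + 1) + Ch * 3 powr Q * 2 powr \<alpha>)
      * H * dist x y powr \<alpha>"
proof -
  define d where "d = dist x y"
  define S where "S = Ch * 2 powr Q / (1 - 2 powr (-\<alpha>))"
  have "0 < d" "3 * d < R" using xy by (auto simp: d_def)
  then have d: "0 < d" "3 * d < R" "2 * d < R" "d < R" by linarith+
  let ?mx = "mean_value M (ball x (2 * d)) u" and ?my = "mean_value M (ball y d) u"
  have 1: "\<bar>?mx - u x\<bar> \<le> S * H * (2 * d) powr \<alpha>"
    unfolding S_def using xy d u \<alpha> H int osc[of x, folded d_def]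
    by (intro mean_value_to_centre) auto
  have 2: "\<bar>?my - u y\<bar> \<le> S * H * d powr \<alpha>"
    unfolding S_def using xy d u \<alpha> H int osc[of y, folded d_def]
    by (intro mean_value_to_centre) auto
  have pos: "0 < measure M (ball y d)" using d by (simp add: ball_pos)
  have sub: "ball y d \<subseteq> ball x (2 * d)"
  proof
    fix w assume "w \<in> ball y d"
    then show "w \<in> ball x (2 * d)" using dist_triangle[of x w y] by (simp add: d_def)
  qed
  have "\<bar>?my - ?mx\<bar> \<le> (LINT w:ball x (2 * d)|M. \<bar>u w - ?mx\<bar>) / measure M (ball y d)"
    using sub d pos ball_mass[of "2 * d" x] int
    by (intro mean_value_deviation) (auto simp: ball_sets)
  also have "\<dots> \<le> (H * (2 * d) powr \<alpha> * measure M (ball x (2 * d))) / measure M (ball y d)"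
    using osc[of x "2 * d"] d pos by (intro divide_right_mono) (auto simp: d_def)
  also have "\<dots> \<le> (H * (2 * d) powr \<alpha> * (Ch * 3 powr Q * measure M (ball y d))) / measure M (ball y d)"
    using ball_in_triple[of x y d] d xy pos H by (intro divide_right_mono mult_left_mono) (auto simp: d_def)
  also have "\<dots> = Ch * 3 powr Q * H * (2 * d) powr \<alpha>"
    using pos by simp
  finally have 3: "\<bar>?my - ?mx\<bar> \<le> Ch * 3 powr Q * H * (2 * d) powr \<alpha>" .
  have "\<bar>u x - u y\<bar> \<le> S * H * (2 * d) powr \<alpha> + S * H * d powr \<alpha> + Ch * 3 powr Q * H * (2 * d) powr \<alpha>"
    using 1 2 3 by linarith
  also have "\<dots> = (S * (2 powr \<alpha> + 1) + Ch * 3 powr Q * 2 powr \<alpha>) * H * d powr \<alpha>"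
    using d by (simp add: powr_mult algebra_simps)
  finally show ?thesis by (simp add: S_def d_def)
qed

section \<open>Bounded overlap\<close>

text \<open>If a point \<open>y\<close> lies in several of the enlarged balls, then the corresponding small balls are disjoint,
lie in one ball of comparable radius, and each has a fixed fraction of its mass. Hence their number
is bounded independently of \<open>y\<close>, and integrating this pointwise count against \<open>h\<close> gives the claim.\<close>

lemma sum_enlarged_balls:
  fixes z :: "'i \<Rightarrow> 'a"
  assumes S: "finite S" "z ` S \<subseteq> K" and "0 < \<epsilon>" "\<epsilon> < 1" "1 \<le> \<Lambda>" "0 < r" "(4 * \<Lambda> + 1) * r < R"
    and disj: "\<And>i j. i \<in> S \<Longrightarrow> j \<in> S \<Longrightarrow> i \<noteq> j \<Longrightarrow> ball (z i) (\<epsilon> * r) \<inter> ball (z j) (\<epsilon> * r) = {}"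
    and h: "h \<in> borel_measurable M"
    and B: "\<And>i. i \<in> S \<Longrightarrow> ball (z i) (\<Lambda> * r) \<subseteq> B" "B \<in> sets M"
  shows "(\<Sum>i\<in>S. \<integral>\<^sup>+y\<in>ball (z i) (\<Lambda> * r). h y \<partial>M)
      \<le> ennreal (Ch * ((4 * \<Lambda> + 1) / \<epsilon>) powr Q) * (\<integral>\<^sup>+y\<in>B. h y \<partial>M)"
proof -
  define T where "T = 4 * \<Lambda> + 1"
  define N where "N = Ch * (T / \<epsilon>) powr Q"
  note [measurable] = h B(2)
  have T: "1 < T" "T * r < R" using assms by (auto simp: T_def)
  have N: "0 \<le> N" using Ch_ge by (simp add: N_def)
  have card: "real (card {i\<in>S. y \<in> ball (z i) (\<Lambda> * r)}) \<le> N" for y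
  proof (cases "{i\<in>S. y \<in> ball (z i) (\<Lambda> * r)} = {}")
    case True
    then show ?thesis by (simp only: True) (simp add: N)
  next
    case False
    let ?Sy = "{i\<in>S. y \<in> ball (z i) (\<Lambda> * r)}"
    from False obtain j where j: "j \<in> ?Sy" by auto
    let ?D = "ball (z j) ((2 * \<Lambda> + 1) * r)"
    have Dpos: "0 < measure M ?D" using assms by (intro ball_pos mult_pos_pos) auto
    have near: "dist (z i) (z j) < 2 * \<Lambda> * r" if "i \<in> ?Sy" for i
      using that j dist_triangle2[of "z i" "z j" y] by (auto simp: dist_commute)
    have each: "measure M ?D \<le> N * measure M (ball (z i) (\<epsilon> * r))" if i: "i \<in> ?Sy" for i
    proof -
      have "?D \<subseteq> ball (z i) (T * r)"
      proof
        fix w assume "w \<in> ?D"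
        then show "w \<in> ball (z i) (T * r)"
          using near[OF i] dist_triangle[of "z i" w "z j"] by (simp add: T_def algebra_simps)
      qed
      then have "measure M ?D \<le> measure M (ball (z i) (T * r))"
        by (intro measure_mono_fmeasurable) (auto simp: ball_sets ball_fmeasurable)
      also have "\<dots> \<le> Ch * (T * r / (\<epsilon> * r)) powr Q * measure M (ball (z i) (\<epsilon> * r))"
        using i S assms T by (intro homogeneous) auto
      finally show ?thesis using assms by (simp add: N_def)
    qed
    have "real (card ?Sy) * measure M ?D = (\<Sum>i\<in>?Sy. measure M ?D)"
      by simp
    also have "\<dots> \<le> (\<Sum>i\<in>?Sy. N * measure M (ball (z i) (\<epsilon> * r)))"
      by (intro sum_mono each)
    also have "\<dots> = N * (\<Sum>i\<in>?Sy. measure M (ball (z i) (\<epsilon> * r)))"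
      by (simp add: sum_distrib_left)
    also have "(\<Sum>i\<in>?Sy. measure M (ball (z i) (\<epsilon> * r))) = measure M (\<Union>i\<in>?Sy. ball (z i) (\<epsilon> * r))"
      using S disj by (intro measure_UNION'[symmetric] ball_fmeasurable) (auto simp: pairwise_def disjnt_def)
    also have "N * \<dots> \<le> N * measure M ?D"
    proof (intro mult_left_mono measure_mono_fmeasurable N)
      show "(\<Union>i\<in>?Sy. ball (z i) (\<epsilon> * r)) \<subseteq> ?D"
      proof
        fix w assume "w \<in> (\<Union>i\<in>?Sy. ball (z i) (\<epsilon> * r))"
        then obtain i where i: "i \<in> ?Sy" "dist (z i) w < \<epsilon> * r" by auto
        have "\<epsilon> * r \<le> 1 * r" using assms by (intro mult_right_mono) auto
        then show "w \<in> ?D"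
          using near[OF i(1)] i(2) dist_triangle3[of "z j" w "z i"] by (simp add: dist_commute algebra_simps)
      qed
    qed (use S in \<open>auto simp: ball_sets ball_fmeasurable\<close>)
    finally show ?thesis using Dpos by simp
  qed
  have "(\<Sum>i\<in>S. \<integral>\<^sup>+y\<in>ball (z i) (\<Lambda> * r). h y \<partial>M)
      = (\<integral>\<^sup>+y. (\<Sum>i\<in>S. h y * indicator (ball (z i) (\<Lambda> * r)) y) \<partial>M)"
    by (intro nn_integral_sum[symmetric]) measurable
  also have "\<dots> \<le> (\<integral>\<^sup>+y. ennreal N * (h y * indicator B y) \<partial>M)"
  proof (rule nn_integral_mono)
    fix y
    let ?Sy = "{i\<in>S. y \<in> ball (z i) (\<Lambda> * r)}"
    have "(\<Sum>i\<in>S. h y * indicator (ball (z i) (\<Lambda> * r)) y) = h y * (\<Sum>i\<in>S. indicator (ball (z i) (\<Lambda> * r)) y)"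
      by (simp add: sum_distrib_left)
    also have "(\<Sum>i\<in>S. indicator (ball (z i) (\<Lambda> * r)) y :: ennreal) = of_nat (card ?Sy)"
      using S by (simp add: indicator_def of_bool_def sum.If_cases Int_def)
    also have "h y * of_nat (card ?Sy) \<le> ennreal N * (h y * indicator B y)"
    proof (cases "?Sy = {}")
      case True
      then show ?thesis by (simp only: True) simp
    next
      case False
      then have "y \<in> B" using B(1) by blast
      have "(of_nat (card ?Sy) :: ennreal) \<le> ennreal N"
        using card[of y] by (simp add: ennreal_of_nat_eq_real_of_nat ennreal_leI)
      then have "of_nat (card ?Sy) * h y \<le> ennreal N * h y" by (rule mult_right_mono) simp
      then show ?thesis using \<open>y \<in> B\<close> by (simp add: mult.commute)
    qed
    finally show "(\<Sum>i\<in>S. h y * indicator (ball (z i) (\<Lambda> * r)) y) \<le> ennreal N * (h y * indicator B y)" .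
  qed
  also have "\<dots> = ennreal N * (\<integral>\<^sup>+y\<in>B. h y \<partial>M)"
    by (intro nn_integral_cmult) measurable
  finally show ?thesis by (simp add: N_def T_def)
qed

end

section \<open>Hoelder coefficients of a map with an upper gradient\<close>

lemma upper_gradient_dist:
  assumes "upper_gradient f g"
  shows "upper_gradient (\<lambda>x. dist (f x) a) g"
  unfolding upper_gradient_def
proof (intro conjI allI impI)
  show "g \<in> borel_measurable borel"
    using assms by (simp add: upper_gradient_def)
  fix \<gamma> :: "real \<Rightarrow> 'a" assume "rectifiable_curve \<gamma>"
  then have "ennreal (dist (f (\<gamma> 0)) (f (\<gamma> 1))) \<le> curve_integral \<gamma> g"
    using assms by (simp add: upper_gradient_def)
  moreover have "dist (dist (f (\<gamma> 0)) a) (dist (f (\<gamma> 1)) a) \<le> dist (f (\<gamma> 0)) (f (\<gamma> 1))"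
    using dist_triangle[of "f (\<gamma> 0)" a "f (\<gamma> 1)"] dist_triangle3[of "f (\<gamma> 1)" a "f (\<gamma> 0)"]
    by (simp add: dist_real_def)
  ultimately show "ennreal (dist (dist (f (\<gamma> 0)) a) (dist (f (\<gamma> 1)) a)) \<le> curve_integral \<gamma> g"
    using ennreal_leI order_trans by blast
qed

context homogeneous_region
begin

text \<open>Any \<open>J > 0\<close> above the integral of \<open>g\<^sup>q\<close> over \<open>ball z (5 * \<kappa> * r)\<close> bounds the \<open>q\<close>-mean of \<open>g\<close>
over every \<open>ball w (\<kappa> * s)\<close> that occurs in the two-point estimate by a multiple of
\<open>(J / s\<^sup>Q)\<close> to the power \<open>1/q\<close>, by the lower mass bound. So the mean oscillations have order \<open>s\<close> to
the power \<open>1 - Q/q\<close>. The estimate is carried out for \<open>J > 0\<close> and passed to the integral itself at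
the end, which also covers the case that the integral vanishes.\<close>

lemma morrey_holder:
  fixes f :: "'a \<Rightarrow> 'b::metric_space"
  assumes q: "Q < q" and C: "0 < C" and \<kappa>: "1 \<le> \<kappa>"
    and osc: "oscillation_controlled M q g C \<kappa>"
    and int: "\<And>(u :: 'a \<Rightarrow> real) x r. continuous_on UNIV u \<Longrightarrow> set_integrable M (ball x r) u"
    and f: "continuous_on UNIV f" "upper_gradient f g"
  obtains D where "0 < D"
    "\<And>z r. 0 < r \<Longrightarrow> ball z r \<subseteq> K \<Longrightarrow> 6 * \<kappa> * r < R \<Longrightarrow>
      ennpowr (holder_coeff (1 - Q / q) (ball z r) f) q
      \<le> ennreal D * (\<integral>\<^sup>+y\<in>ball z (5 * \<kappa> * r). ennpowr (g y) q \<partial>M)"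
proof -
  define \<alpha> where "\<alpha> = 1 - Q / q"
  have q0: "0 < q" using q Q_pos by simp
  have \<alpha>: "0 < \<alpha>" using q Q_pos by (simp add: \<alpha>_def)
  \<comment> \<open>The constant of the two-point estimate.\<close>
  define S where "S = Ch * 2 powr Q / (1 - 2 powr (-\<alpha>)) * (2 powr \<alpha> + 1) + Ch * 3 powr Q * 2 powr \<alpha>"
  have "2 powr (-\<alpha>) < 1" using \<alpha> by (simp add: powr_less_one)
  then have S: "0 < S" unfolding S_def using Ch_ge by (intro add_pos_pos mult_pos_pos divide_pos_pos) auto
  define L where "L = S * (C / (c * \<kappa> powr Q) powr (1 / q))"
  have L: "0 < L" unfolding L_def using S C c_pos \<kappa> by simp
  have holder: "dist (f x) (f y) \<le> L * J powr (1 / q) * dist x y powr \<alpha>"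
    if r: "0 < r" "ball z r \<subseteq> K" "6 * \<kappa> * r < R" and J: "0 < J"
      and le: "(\<integral>\<^sup>+y\<in>ball z (5 * \<kappa> * r). ennpowr (g y) q \<partial>M) \<le> ennreal J"
      and xy: "x \<in> ball z r" "y \<in> ball z r" "x \<noteq> y" for z r J x y
  proof -
    define u where "u w = dist (f w) (f y)" for w
    define H where "H = C / (c * \<kappa> powr Q) powr (1 / q) * J powr (1 / q)"
    have H: "0 \<le> H" using C by (simp add: H_def)
    have u: "upper_gradient u g" unfolding u_def using f(2) by (rule upper_gradient_dist)
    have cu: "continuous_on UNIV u" unfolding u_def by (intro continuous_intros f)
    have \<kappa>r: "1 * r \<le> \<kappa> * r" using \<kappa> r by (intro mult_right_mono) auto
    have d: "dist x y < 2 * r" using xy dist_triangle3[of x y z] by simp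
    have "\<bar>u x - u y\<bar> \<le> S * H * dist x y powr \<alpha>"
      unfolding S_def
    proof (rule two_point_estimate)
      show "3 * dist x y < R" using d \<kappa>r r(3) by linarith
      fix w s assume w: "w \<in> {x, y}" and s: "0 < s" "s \<le> 2 * dist x y"
      define t where "t = (J / (c * (\<kappa> * s) powr Q)) powr (1 / q)"
      have t: "0 < t" using J c_pos \<kappa> s by (simp add: t_def)
      have "\<kappa> * s \<le> \<kappa> * (4 * r)" using s d \<kappa> by (intro mult_left_mono) auto
      then have \<kappa>s: "\<kappa> * s \<le> 4 * (\<kappa> * r)" "0 < \<kappa> * s" using \<kappa> s by auto
      have \<kappa>sR: "\<kappa> * s < R" using \<kappa>s(1) \<kappa>r r by linarith
      \<comment> \<open>Since \<open>s \<le> 2 * dist x y < 4 * r\<close>, the total distance from \<open>z\<close> is below \<open>r + 4 * \<kappa> * r \<le> 5 * \<kappa> * r\<close>.\<close>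
      have sub: "ball w (\<kappa> * s) \<subseteq> ball z (5 * \<kappa> * r)"
      proof
        fix v assume v: "v \<in> ball w (\<kappa> * s)"
        have "dist z w < r" using w xy by auto
        then show "v \<in> ball z (5 * \<kappa> * r)"
          using v \<kappa>s \<kappa>r dist_triangle[of z v w] unfolding mem_ball by linarith
      qed
      have "(\<integral>\<^sup>+y\<in>ball w (\<kappa> * s). ennpowr (g y) q \<partial>M) \<le> (\<integral>\<^sup>+y\<in>ball z (5 * \<kappa> * r). ennpowr (g y) q \<partial>M)"
        using sub by (rule nn_set_integral_set_mono)
      also have "\<dots> \<le> ennreal J" by (rule le)
      also have "J = t powr q * (c * (\<kappa> * s) powr Q)"
        using J c_pos \<kappa> s q0 by (simp add: t_def powr_powr)
      also have "ennreal \<dots> \<le> ennreal (t powr q * measure M (ball w (\<kappa> * s)))"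
        using w xy r \<kappa>s \<kappa>sR
        by (intro ennreal_leI mult_left_mono lower_mass) auto
      also have "\<dots> = ennreal (t powr q) * emeasure M (ball w (\<kappa> * s))"
        using emeasure_eq_measure2[OF ball_fmeasurable] by (simp add: ennreal_mult)
      finally have "(LINT y:ball w s|M. \<bar>u y - mean_value M (ball w s) u\<bar>) \<le> C * s * t * measure M (ball w s)"
        using osc u t s int[OF cu] unfolding oscillation_controlled_def by blast
      also have "C * s * t = H * s powr \<alpha>"
      proof -
        have "s powr \<alpha> = s / s powr (Q / q)" using s by (simp add: \<alpha>_def powr_diff)
        then show ?thesis
          using s J c_pos \<kappa> by (simp add: t_def H_def powr_divide powr_mult powr_powr mult_ac)
      qed
      finally show "(LINT y:ball w s|M. \<bar>u y - mean_value M (ball w s) u\<bar>) \<le> H * s powr \<alpha> * measure M (ball w s)" .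
    qed (use xy r \<alpha> H cu int in \<open>auto simp: continuous_on_eq_continuous_at\<close>)
    then show ?thesis by (simp add: u_def L_def H_def mult_ac)
  qed
  show thesis
  proof (rule that[of "L powr q"])
    show "0 < L powr q" using L by simp
    fix z :: 'a and r :: real assume r: "0 < r" "ball z r \<subseteq> K" "6 * \<kappa> * r < R"
    let ?I = "\<integral>\<^sup>+y\<in>ball z (5 * \<kappa> * r). ennpowr (g y) q \<partial>M"
    have bound: "ennpowr (holder_coeff (1 - Q / q) (ball z r) f) q \<le> ennreal (L powr q * J)"
      if J: "0 < J" "?I \<le> ennreal J" for J
    proof -
      have "holder_coeff (1 - Q / q) (ball z r) f \<le> ennreal (L * J powr (1 / q))"
        unfolding holder_coeff_def
        using holder[OF r J]
        by (auto intro!: SUP_least ennreal_leI simp: divide_le_eq \<alpha>_def)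
      then have "ennpowr (holder_coeff (1 - Q / q) (ball z r) f) q \<le> ennpowr (ennreal (L * J powr (1 / q))) q"
        using q0 by (intro ennpowr_mono) auto
      also have "\<dots> = ennreal (L powr q * J)"
        using L J q0 by (simp add: ennpowr_ennreal powr_mult powr_powr)
      finally show ?thesis .
    qed
    show "ennpowr (holder_coeff (1 - Q / q) (ball z r) f) q \<le> ennreal (L powr q) * ?I"
    proof (cases ?I)
      case top
      then show ?thesis using L by (simp add: ennreal_mult_top)
    next
      case (real j)
      show ?thesis
      proof (rule ennreal_le_epsilon)
        fix e :: real assume e: "0 < e"
        have "ennpowr (holder_coeff (1 - Q / q) (ball z r) f) q \<le> ennreal (L powr q * (j + e / L powr q))"
          using real e L by (intro bound) (auto intro!: ennreal_leI add_nonneg_pos)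
        also have "\<dots> = ennreal (L powr q) * ?I + ennreal e"
          using real e L by (simp add: ennreal_mult[symmetric] ennreal_plus[symmetric] algebra_simps del: ennreal_plus)
        finally show "ennpowr (holder_coeff (1 - Q / q) (ball z r) f) q \<le> ennreal (L powr q) * ?I + ennreal e" .
      qed
    qed
  qed
qed

end

text \<open>Morrey's estimate bounds each term by an integral of \<open>g\<^sup>q\<close>, and bounded overlap sums these
integrals. The form is stronger than the compact Hoelder property in three respects that the
dimension estimate relies on: the balls need not cover a given set, they may be indexed by any type (there, by their
centres), and the endpoint \<open>q = p\<close> is included.\<close>

lemma holder_sum_bounded:
  fixes M :: "'a::metric_space measure" and f :: "'a \<Rightarrow> 'b::metric_space" and A :: "'a set"
  assumes Q: "0 < Q" and mms: "metric_measure_space M"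
    and proper: "\<forall>S :: 'a set. closed S \<and> bounded S \<longrightarrow> compact S"
    and hom: "locally_homogeneous Q M" and poincare: "poincare_inequality Q M"
    and f: "continuous_on UNIV f" "upper_gradient f g" and g: "Lp_loc p M g"
    and q: "Q < q" "q \<le> p" and \<epsilon>: "0 < \<epsilon>" "\<epsilon> < 1" and A: "bounded A"
  shows "\<exists>r0>0. \<exists>C>0. \<forall>(S :: 'i set) z r.
      finite S \<longrightarrow> z ` S \<subseteq> A \<longrightarrow> 0 < r \<longrightarrow> r < r0 \<longrightarrow>
      (\<forall>i\<in>S. \<forall>j\<in>S. i \<noteq> j \<longrightarrow> ball (z i) (\<epsilon> * r) \<inter> ball (z j) (\<epsilon> * r) = {}) \<longrightarrow>
      (\<Sum>i\<in>S. ennpowr (holder_coeff (1 - Q / q) (ball (z i) r) f) q) \<le> ennreal C"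
proof -
  obtain x0 \<rho> where \<rho>: "A \<subseteq> cball x0 \<rho>"
    using A by (meson bounded_subset_cball)
  define K where "K = cball x0 (\<rho> + 1)"
  have cK: "compact (cball x0 s)" for s using proper by simp
  obtain Ch c R where "homogeneous_region M K Q Ch c R"
    using homogeneous_region_exists[OF Q mms hom cK] unfolding K_def by metis
  then interpret homogeneous_region M K Q Ch c R .
  obtain Cp \<kappa> where \<kappa>: "0 < Cp" "1 \<le> \<kappa>"
    and osc: "oscillation_controlled M q g Cp \<kappa>"
    using poincare_oscillation[OF poincare Q mms] less_imp_le[OF q(1)] by metis
  obtain D where D: "0 < D"
    "\<And>z r. 0 < r \<Longrightarrow> ball z r \<subseteq> K \<Longrightarrow> 6 * \<kappa> * r < R \<Longrightarrow>
      ennpowr (holder_coeff (1 - Q / q) (ball z r) f) q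
      \<le> ennreal D * (\<integral>\<^sup>+y\<in>ball z (5 * \<kappa> * r). ennpowr (g y) q \<partial>M)"
    using morrey_holder[OF q(1) \<kappa> osc continuous_set_integrable_ball[OF mms proper] f] by blast
  define B where "B = cball x0 (\<rho> + 5 * \<kappa>)"
  have gm [measurable]: "g \<in> borel_measurable M" using g by (simp add: Lp_loc_def)
  have B: "B \<in> fmeasurable M"
  proof (rule fmeasurableI2[OF ball_fmeasurable])
    show "B \<subseteq> ball x0 (\<rho> + 5 * \<kappa> + 1)" by (auto simp: B_def)
    show "B \<in> sets M" by (simp add: B_def sets_eq)
  qed
  define I where "I = (\<integral>\<^sup>+y\<in>B. ennpowr (g y) q \<partial>M)"
  have Ip: "(\<integral>\<^sup>+y\<in>B. ennpowr (g y) p \<partial>M) < \<infinity>"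
    unfolding B_def by (rule Lp_loc_compact[OF g sets_eq cK])
  have I: "I < \<infinity>"
    unfolding I_def using q Q by (intro ennpowr_integral_finite_lower_exponent[OF gm B _ q(2) Ip]) simp
  define N where "N = Ch * ((4 * (5 * \<kappa>) + 1) / \<epsilon>) powr Q"
  have N: "0 \<le> N" using Ch_ge by (simp add: N_def)
  define C where "C = D * (N * enn2real I) + 1"
  show ?thesis
  \<comment> \<open>Here \<open>20 * \<kappa> + 1\<close> is \<open>4 * \<Lambda> + 1\<close> for the dilation factor \<open>\<Lambda> = 5 * \<kappa>\<close> of Morrey's estimate.\<close>
  proof (rule exI[of _ "min 1 (R / (20 * \<kappa> + 1))"], intro conjI exI[of _ C] allI impI)
    show "0 < min 1 (R / (20 * \<kappa> + 1))" using \<kappa> R_pos by simp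
    show "0 < C" using D N by (simp add: C_def add_nonneg_pos)
    fix S :: "'i set" and z r
    assume S: "finite S" "z ` S \<subseteq> A" and r: "0 < r" "r < min 1 (R / (20 * \<kappa> + 1))"
      and disj: "\<forall>i\<in>S. \<forall>j\<in>S. i \<noteq> j \<longrightarrow> ball (z i) (\<epsilon> * r) \<inter> ball (z j) (\<epsilon> * r) = {}"
    have r1: "r < 1" "(20 * \<kappa> + 1) * r < R"
      using r \<kappa> by (auto simp: pos_less_divide_eq mult.commute)
    have "6 * \<kappa> * r \<le> (20 * \<kappa> + 1) * r" using r \<kappa> by (intro mult_right_mono) auto
    then have r6: "6 * \<kappa> * r < R" using r1 by linarith
    have zi: "dist x0 (z i) \<le> \<rho>" if "i \<in> S" for i
    proof -
      have "z i \<in> cball x0 \<rho>" using that S \<rho> by blast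
      then show ?thesis by simp
    qed
    have grow: "ball (z i) s \<subseteq> cball x0 (\<rho> + t)" if "i \<in> S" "s \<le> t" for i s t
    proof
      fix w assume "w \<in> ball (z i) s"
      then show "w \<in> cball x0 (\<rho> + t)" using zi[OF that(1)] that(2) dist_triangle[of x0 w "z i"] by simp
    qed
    have "(\<Sum>i\<in>S. ennpowr (holder_coeff (1 - Q / q) (ball (z i) r) f) q)
        \<le> (\<Sum>i\<in>S. ennreal D * (\<integral>\<^sup>+y\<in>ball (z i) (5 * \<kappa> * r). ennpowr (g y) q \<partial>M))"
      using r r1 r6 grow[of _ r 1] by (intro sum_mono D(2)) (auto simp: K_def)
    also have "\<dots> = ennreal D * (\<Sum>i\<in>S. \<integral>\<^sup>+y\<in>ball (z i) (5 * \<kappa> * r). ennpowr (g y) q \<partial>M)"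
      by (simp add: sum_distrib_left)
    also have "\<dots> \<le> ennreal D * (ennreal N * I)"
      unfolding N_def I_def
    proof (intro mult_left_mono sum_enlarged_balls S(1) \<epsilon> r(1))
      show "z ` S \<subseteq> K" using zi by (force simp: K_def)
      show "(4 * (5 * \<kappa>) + 1) * r < R" using r1 by simp
      have "5 * \<kappa> * r \<le> 5 * \<kappa> * 1" using \<kappa> r1 by (intro mult_left_mono) auto
      then show "ball (z i) (5 * \<kappa> * r) \<subseteq> B" if "i \<in> S" for i
        unfolding B_def using grow[OF that] by simp
      show "B \<in> sets M" using B by (rule fmeasurableD)
    qed (use \<kappa> disj in auto)
    also have "\<dots> = ennreal (D * (N * enn2real I))"
      using I D N by (simp add: ennreal_mult less_top)
    also have "\<dots> \<le> ennreal C" by (intro ennreal_leI) (simp add: C_def)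
    finally show "(\<Sum>i\<in>S. ennpowr (holder_coeff (1 - Q / q) (ball (z i) r) f) q) \<le> ennreal C" .
  qed
qed

lemma compactly_holder_if_sums_bounded:
  fixes f :: "'a::metric_space \<Rightarrow> 'b::metric_space"
  assumes "\<And>A \<epsilon>. bounded A \<Longrightarrow> 0 < \<epsilon> \<Longrightarrow> \<epsilon> < 1 \<Longrightarrow> \<exists>r0>0. \<exists>C>0. \<forall>(S :: nat set) z r.
      finite S \<longrightarrow> z ` S \<subseteq> A \<longrightarrow> 0 < r \<longrightarrow> r < r0 \<longrightarrow>
      (\<forall>i\<in>S. \<forall>j\<in>S. i \<noteq> j \<longrightarrow> ball (z i) (\<epsilon> * r) \<inter> ball (z j) (\<epsilon> * r) = {}) \<longrightarrow>
      (\<Sum>i\<in>S. ennpowr (holder_coeff \<alpha> (ball (z i) r) f) s) \<le> ennreal C"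
  shows "compactly_holder s \<alpha> f"
  unfolding compactly_holder_def
proof (intro allI impI)
  fix E :: "'a set" and \<epsilon> :: real
  assume E: "compact E" and \<epsilon>: "0 < \<epsilon>" "\<epsilon> < 1"
  obtain a \<rho> where \<rho>: "E \<subseteq> cball a \<rho>"
    using compact_imp_bounded[OF E] by (meson bounded_subset_cball)
  obtain r0 C where r0: "0 < r0" "0 < C" and sums: "\<And>(S :: nat set) z r.
      finite S \<Longrightarrow> z ` S \<subseteq> cball a (\<rho> + 1) \<Longrightarrow> 0 < r \<Longrightarrow> r < r0 \<Longrightarrow>
      \<forall>i\<in>S. \<forall>j\<in>S. i \<noteq> j \<longrightarrow> ball (z i) (\<epsilon> * r) \<inter> ball (z j) (\<epsilon> * r) = {} \<Longrightarrow>
      (\<Sum>i\<in>S. ennpowr (holder_coeff \<alpha> (ball (z i) r) f) s) \<le> ennreal C"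
    using assms[OF bounded_cball[of a "\<rho> + 1"] \<epsilon>] by blast
  show "\<exists>rE>0. \<exists>C>0. \<forall>(I :: nat set) (x :: nat \<Rightarrow> 'a) r.
          0 < r \<longrightarrow> r < rE \<longrightarrow>
          E \<subseteq> (\<Union>i\<in>I. ball (x i) r) \<longrightarrow>
          (\<forall>i\<in>I. ball (x i) r \<inter> E \<noteq> {}) \<longrightarrow>
          (\<forall>i\<in>I. \<forall>j\<in>I. i \<noteq> j \<longrightarrow> ball (x i) (\<epsilon> * r) \<inter> ball (x j) (\<epsilon> * r) = {}) \<longrightarrow>
          (\<Sum>\<^sub>\<infinity>i\<in>I. ennpowr (holder_coeff \<alpha> (ball (x i) r) f) s) \<le> ennreal C"
  proof (rule exI[of _ "min r0 1"], intro conjI exI[of _ C] allI impI)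
    fix I :: "nat set" and x :: "nat \<Rightarrow> 'a" and r :: real
    assume r: "0 < r" "r < min r0 1" and meet: "\<forall>i\<in>I. ball (x i) r \<inter> E \<noteq> {}"
      and disj: "\<forall>i\<in>I. \<forall>j\<in>I. i \<noteq> j \<longrightarrow> ball (x i) (\<epsilon> * r) \<inter> ball (x j) (\<epsilon> * r) = {}"
    have near: "x i \<in> cball a (\<rho> + 1)" if i: "i \<in> I" for i
    proof -
      obtain e where e: "e \<in> E" "dist (x i) e < r" using meet i by force
      then have "dist a e \<le> \<rho>" using \<rho> by auto
      with e r show ?thesis using dist_triangle2[of a "x i" e] by simp
    qed
    show "(\<Sum>\<^sub>\<infinity>i\<in>I. ennpowr (holder_coeff \<alpha> (ball (x i) r) f) s) \<le> ennreal C"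
    proof (subst nonneg_infsum_complete, simp, rule SUP_least)
      fix F assume "F \<in> {F. finite F \<and> F \<subseteq> I}"
      then show "(\<Sum>i\<in>F. ennpowr (holder_coeff \<alpha> (ball (x i) r) f) s) \<le> ennreal C"
        using r near disj by (intro sums) auto
    qed
  qed (use r0 in auto)
qed

section \<open>Covering numbers and Minkowski dimension\<close>

definition separated :: "real \<Rightarrow> 'a::metric_space set \<Rightarrow> bool" where
  "separated \<rho> S \<longleftrightarrow> finite S \<and> (\<forall>x\<in>S. \<forall>y\<in>S. x \<noteq> y \<longrightarrow> \<rho> \<le> dist x y)"

text \<open>A separated subset of largest cardinality works: a point at distance at least \<open>\<rho>\<close> from all its
elements could be added to it.\<close>

lemma maximal_separated_net:
  fixes A :: "'a::metric_space set"
  assumes \<rho>: "0 < \<rho>" and bound: "\<And>S. S \<subseteq> A \<Longrightarrow> separated \<rho> S \<Longrightarrow> real (card S) \<le> N"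
  obtains S where "S \<subseteq> A" "separated \<rho> S" "A \<subseteq> (\<Union>x\<in>S. ball x \<rho>)"
proof -
  let ?P = "\<lambda>S. S \<subseteq> A \<and> separated \<rho> S"
  have "?P {}" by (simp add: separated_def)
  moreover have "\<forall>S. ?P S \<longrightarrow> card S \<le> nat \<lfloor>N\<rfloor>"
    using bound by (auto simp: le_nat_floor)
  ultimately have "\<exists>S. ?P S \<and> (\<forall>S'. ?P S' \<longrightarrow> card S' \<le> card S)"
    by (intro ex_has_greatest_nat[of ?P "{}" card "Suc (nat \<lfloor>N\<rfloor>)"]) (auto simp: less_Suc_eq_le)
  then obtain S where S: "?P S" and max: "\<And>S'. ?P S' \<Longrightarrow> card S' \<le> card S"
    by (elim exE conjE) simp
  have fin: "finite S" using S by (simp add: separated_def)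
  have "A \<subseteq> (\<Union>x\<in>S. ball x \<rho>)"
  proof (rule subsetI, rule ccontr)
    fix a assume a: "a \<in> A" "a \<notin> (\<Union>x\<in>S. ball x \<rho>)"
    then have far: "\<rho> \<le> dist x a" if "x \<in> S" for x using that by force
    then have "a \<notin> S" using \<rho> by force
    have "?P (insert a S)"
      using S a(1) far by (auto simp: separated_def dist_commute)
    from max[OF this] show False using \<open>a \<notin> S\<close> fin by simp
  qed
  with S that show thesis by blast
qed

text \<open>A set of diameter at most \<open>r\<close> contains at most one point of an \<open>\<rho>\<close>-separated set when \<open>r < \<rho>\<close>.\<close>

lemma separated_card_le_covering_number:
  assumes S: "S \<subseteq> E" "separated \<rho> S" and r: "r < \<rho>" and cov: "covering_number E r = enat n"
  shows "card S \<le> n"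
proof -
  have "covering_number E r < enat (Suc n)" by (simp add: cov)
  then obtain \<C> where \<C>: "finite \<C>" "E \<subseteq> \<Union>\<C>" "\<forall>T\<in>\<C>. bounded T \<and> diameter T \<le> r"
    and card: "card \<C> \<le> n"
    unfolding covering_number_def INF_less_iff by auto
  have "\<forall>x\<in>S. \<exists>T\<in>\<C>. x \<in> T" using S \<C> by blast
  then obtain T where T: "\<And>x. x \<in> S \<Longrightarrow> T x \<in> \<C>" "\<And>x. x \<in> S \<Longrightarrow> x \<in> T x" by metis
  have "inj_on T S"
  proof (rule inj_onI, rule ccontr)
    fix x y assume xy: "x \<in> S" "y \<in> S" "T x = T y" "x \<noteq> y"
    then have "dist x y \<le> diameter (T x)"
      using T \<C> by (intro diameter_bounded_bound) auto
    also have "\<dots> \<le> r" using xy T \<C> by auto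
    finally show False using xy S r by (force simp: separated_def)
  qed
  then have "card S \<le> card \<C>" using T \<C> by (intro card_inj_on_le) auto
  with card show ?thesis by simp
qed

lemma minkowski_dim_less_imp_covering:
  assumes "minkowski_dim E < ereal d"
  shows "\<forall>\<^sub>F r in at_right 0. \<exists>n. covering_number E r = enat n \<and> real n \<le> r powr (-d)"
proof -
  have "\<forall>\<^sub>F r in at_right 0. enat_ln (covering_number E r) / ereal (ln (1 / r)) < ereal d"
    using assms unfolding minkowski_dim_def by (rule Limsup_lessD)
  moreover have "\<forall>\<^sub>F r in at_right (0::real). r < 1"
    by (auto simp: eventually_at_right_field intro: exI[of _ 1])
  moreover have "\<forall>\<^sub>F r in at_right (0::real). 0 < r"
    by (rule eventually_at_right_less)
  ultimately show ?thesis
  proof eventually_elim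
    case (elim r)
    have L: "0 < ln (1 / r)" using elim by simp
    show ?case
    proof (cases "covering_number E r")
      case infinity
      then show ?thesis using elim L by (simp add: enat_ln_def)
    next
      case (enat n)
      have "real n \<le> r powr (-d)"
      proof (cases "n = 0")
        case False
        have "ln (real n) / ln (1 / r) < d" using elim enat L by (simp add: enat_ln_def)
        then have "ln (real n) < d * ln (1 / r)" using L by (simp add: pos_divide_less_eq)
        also have "\<dots> = ln (r powr (-d))" using elim by (simp add: ln_powr ln_div)
        finally have "ln (real n) < ln (r powr (-d))" .
        then show ?thesis using False elim by (subst (asm) ln_less_cancel_iff) auto
      qed simp
      then show ?thesis using enat by simp
    qed
  qed
qed

lemma minkowski_dim_nonneg: "0 \<le> minkowski_dim E"
proof -
  have "\<forall>\<^sub>F r in at_right (0::real). 0 < r \<and> r < 1"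
    by (auto simp: eventually_at_right_field intro: exI[of _ 1])
  then have "\<forall>\<^sub>F r in at_right 0. 0 \<le> enat_ln (covering_number E r) / ereal (ln (1 / r))"
  proof eventually_elim
    case (elim r)
    then have "0 < ln (1 / r)" by simp
    moreover have "0 \<le> enat_ln (covering_number E r)"
    proof (cases "covering_number E r")
      case (enat n)
      then show ?thesis by (cases n) (auto simp: enat_ln_def)
    qed (simp add: enat_ln_def)
    ultimately show ?case by (intro zero_le_divide_ereal) auto
  qed
  then show ?thesis
    unfolding minkowski_dim_def by (intro le_Limsup) (auto simp: trivial_limit_at_right_real)
qed

text \<open>After taking logarithms, the constant \<open>A\<close> contributes only \<open>ln A / ln (1 / s)\<close>, which tends to \<open>0\<close>.
The condition \<open>1 \<le> A\<close> keeps this bound nonnegative, as needed for the value \<open>ln 0 = 0\<close> when \<open>E\<close>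
is empty.\<close>

lemma minkowski_dim_le_if_covering:
  assumes A: "1 \<le> A" and t: "0 \<le> t"
    and cov: "\<forall>\<^sub>F s in at_right 0. \<exists>n. covering_number E s \<le> enat n \<and> real n \<le> A * s powr (-t)"
  shows "minkowski_dim E \<le> ereal t"
proof -
  have "\<forall>\<^sub>F s in at_right (0::real). 0 < s \<and> s < 1"
    by (auto simp: eventually_at_right_field intro: exI[of _ 1])
  with cov have "\<forall>\<^sub>F s in at_right 0. enat_ln (covering_number E s) / ereal (ln (1 / s))
      \<le> ereal (ln A / ln (1 / s) + t)"
  proof eventually_elim
    case (elim s)
    then obtain n where n: "covering_number E s \<le> enat n" "real n \<le> A * s powr (-t)" by blast
    have L: "0 < ln (1 / s)" using elim by simp
    from n(1) obtain m where m: "covering_number E s = enat m" "m \<le> n"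
      by (cases "covering_number E s") auto
    have "ln (real m) \<le> ln A + t * ln (1 / s)"
    proof (cases "m = 0")
      case True
      then show ?thesis using A t L by simp
    next
      case False
      have "real m \<le> A * s powr (-t)" using m n by linarith
      then have "ln (real m) \<le> ln (A * s powr (-t))" using False by (subst ln_le_cancel_iff) auto
      also have "\<dots> = ln A + t * ln (1 / s)" using A elim by (simp add: ln_mult ln_powr ln_div)
      finally show ?thesis .
    qed
    then have "ln (real m) / ln (1 / s) \<le> (ln A + t * ln (1 / s)) / ln (1 / s)"
      using L by (intro divide_right_mono) auto
    also have "\<dots> = ln A / ln (1 / s) + t" using L by (simp add: add_divide_distrib)
    finally show ?case using m L by (simp add: enat_ln_def)
  qed
  then have "minkowski_dim E \<le> Limsup (at_right 0) (\<lambda>s. ereal (ln A / ln (1 / s) + t))"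
    unfolding minkowski_dim_def by (rule Limsup_mono)
  also have "\<dots> = ereal t"
  proof (rule lim_imp_Limsup)
    have "filterlim (\<lambda>s::real. ln (1 / s)) at_top (at_right 0)"
      using filterlim_compose[OF ln_at_top filterlim_inverse_at_top_right] by (simp add: inverse_eq_divide)
    then have "((\<lambda>s. ln A / ln (1 / s)) \<longlongrightarrow> 0) (at_right 0)"
      by (intro tendsto_divide_0[OF tendsto_const] filterlim_at_top_imp_at_infinity)
    then have "((\<lambda>s. ln A / ln (1 / s) + t) \<longlongrightarrow> 0 + t) (at_right 0)"
      by (intro tendsto_add tendsto_const)
    then show "((\<lambda>s. ereal (ln A / ln (1 / s) + t)) \<longlongrightarrow> ereal t) (at_right 0)" by simp
  qed (simp add: trivial_limit_at_right_real)
  finally show ?thesis .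
qed

section \<open>The dimension of the image\<close>

text \<open>A stopping-time argument. Each point of \<open>E\<close> stops at the first level \<open>k\<close> at which the image of its
ball of radius \<open>\<rho> / 2 ^ k\<close> has diameter at most \<open>s\<close>, and the points that stop at level \<open>k\<close> are
covered by the balls around a maximal separated subset of them. For \<open>k > 0\<close> such points have a
strongly oscillating ball at the previous level, so the assumption \<open>bad\<close> counts them.\<close>

lemma multiscale_covering:
  fixes f :: "'a::metric_space \<Rightarrow> 'b::metric_space"
  assumes \<rho>: "0 < \<rho>" and s: "0 \<le> s" and N: "0 \<le> N1" and \<theta>: "0 \<le> \<theta>" "\<theta> < 1"
    and top: "\<And>S. S \<subseteq> E \<Longrightarrow> separated \<rho> S \<Longrightarrow> real (card S) \<le> N0"
    and bad: "\<And>S k. S \<subseteq> E \<Longrightarrow> separated (\<rho> / 2 ^ Suc k) S \<Longrightarrow>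
       (\<And>x. x \<in> S \<Longrightarrow> \<exists>y\<in>ball x (\<rho> / 2 ^ k). \<exists>w\<in>ball x (\<rho> / 2 ^ k). s < dist (f y) (f w)) \<Longrightarrow>
       real (card S) \<le> N1 * \<theta> ^ k"
    and fine: "\<And>x y w. x \<in> E \<Longrightarrow> y \<in> ball x (\<rho> / 2 ^ m) \<Longrightarrow> w \<in> ball x (\<rho> / 2 ^ m) \<Longrightarrow> dist (f y) (f w) \<le> s"
  shows "\<exists>n. covering_number (f ` E) s \<le> enat n \<and> real n \<le> N0 + N1 / (1 - \<theta>)"
proof -
  define good where "good x k \<longleftrightarrow> (\<forall>y\<in>ball x (\<rho> / 2 ^ k). \<forall>w\<in>ball x (\<rho> / 2 ^ k). dist (f y) (f w) \<le> s)" for x k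
  define level where "level x = (LEAST k. good x k)" for x
  have gm: "good x m" if "x \<in> E" for x using fine[OF that] by (simp add: good_def)
  have good_level: "good x (level x)" and level_le: "level x \<le> m" if "x \<in> E" for x
    using LeastI[of "good x", OF gm[OF that]] Least_le[of "good x", OF gm[OF that]]
    by (simp_all add: level_def)
  define b where "b k = (case k of 0 \<Rightarrow> N0 | Suc j \<Rightarrow> N1 * \<theta> ^ j)" for k
  have count: "real (card S) \<le> b k" if S: "S \<subseteq> {x\<in>E. level x = k}" "separated (\<rho> / 2 ^ k) S" for k S
  proof (cases k)
    case 0
    then show ?thesis using S top[of S] by (auto simp: b_def)
  next
    case (Suc j)
    have "\<exists>y\<in>ball x (\<rho> / 2 ^ j). \<exists>w\<in>ball x (\<rho> / 2 ^ j). s < dist (f y) (f w)" if "x \<in> S" for x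
    proof -
      have "\<not> good x j" using that S Suc not_less_Least[of j "good x"] by (auto simp: level_def)
      then show ?thesis by (auto simp: good_def not_le)
    qed
    then show ?thesis using S Suc bad[of S j] by (auto simp: b_def)
  qed
  define net where "net k S \<longleftrightarrow> S \<subseteq> {x\<in>E. level x = k} \<and> separated (\<rho> / 2 ^ k) S \<and>
      {x\<in>E. level x = k} \<subseteq> (\<Union>x\<in>S. ball x (\<rho> / 2 ^ k))" for k S
  have "\<exists>S. net k S" for k
    unfolding net_def
  proof (rule maximal_separated_net[of "\<rho> / 2 ^ k" "{x\<in>E. level x = k}" "b k"])
    show "0 < \<rho> / 2 ^ k" using \<rho> by simp
  qed (use count in blast)+
  then obtain S where "\<And>k. net k (S k)" by metis
  then have S: "S k \<subseteq> {x\<in>E. level x = k}" "separated (\<rho> / 2 ^ k) (S k)"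
    "{x\<in>E. level x = k} \<subseteq> (\<Union>x\<in>S k. ball x (\<rho> / 2 ^ k))" for k
    by (simp_all only: net_def)
  have fin: "finite (S k)" for k using S(2)[of k] by (simp add: separated_def)
  define \<C> where "\<C> = (\<Union>k\<le>m. (\<lambda>x. f ` ball x (\<rho> / 2 ^ k)) ` S k)"
  have "covering_number (f ` E) s \<le> enat (card \<C>)"
    unfolding covering_number_def
  proof (rule INF_lower, intro CollectI conjI ballI)
    show "finite \<C>" using fin by (simp add: \<C>_def)
    show "f ` E \<subseteq> \<Union>\<C>"
    proof
      fix v assume "v \<in> f ` E"
      then obtain x where x: "x \<in> E" "v = f x" by auto
      then obtain y where "y \<in> S (level x)" "x \<in> ball y (\<rho> / 2 ^ level x)" using S(3)[of "level x"] by blast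
      then show "v \<in> \<Union>\<C>" using x level_le[OF x(1)] unfolding \<C>_def by blast
    qed
    fix T assume "T \<in> \<C>"
    then obtain k x where T: "T = f ` ball x (\<rho> / 2 ^ k)" and x: "x \<in> S k" by (auto simp: \<C>_def)
    have "good x k" using x S(1)[of k] good_level[of x] by auto
    then have le: "dist v w \<le> s" if "v \<in> T" "w \<in> T" for v w using that by (auto simp: T good_def)
    show "diameter T \<le> s" using s le by (rule diameter_le_dist)
    show "bounded T" using le bounded_any_center by (metis bounded_def)
  qed
  moreover have "real (card \<C>) \<le> N0 + N1 / (1 - \<theta>)"
  proof -
    have "card \<C> \<le> (\<Sum>k\<le>m. card ((\<lambda>x. f ` ball x (\<rho> / 2 ^ k)) ` S k))"
      unfolding \<C>_def by (rule card_UN_le) simp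
    also have "\<dots> \<le> (\<Sum>k\<le>m. card (S k))"
      using fin by (intro sum_mono card_image_le)
    finally have "real (card \<C>) \<le> (\<Sum>k\<le>m. real (card (S k)))"
      by (metis of_nat_le_iff of_nat_sum)
    also have "\<dots> \<le> (\<Sum>k\<le>m. b k)" using count S by (intro sum_mono) auto
    also have "\<dots> = N0 + (\<Sum>k<m. N1 * \<theta> ^ k)"
      by (simp add: sum.atMost_shift b_def)
    also have "(\<Sum>k<m. N1 * \<theta> ^ k) = N1 * ((1 - \<theta> ^ m) / (1 - \<theta>))"
      using \<theta> by (simp add: sum_distrib_left[symmetric] sum_gp_strict)
    also have "\<dots> \<le> N1 * (1 / (1 - \<theta>))"
      using \<theta> N by (intro mult_left_mono divide_right_mono) auto
    finally show ?thesis by simp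
  qed
  ultimately show ?thesis by blast
qed

text \<open>The starting radius \<open>\<rho> = s powr (p / (\<beta> + d))\<close> solves
\<open>\<rho> powr (-d) = \<rho> powr \<beta> * s powr (-p)\<close>: it makes the number of balls at level \<open>0\<close> and the
number of balls at the later levels equal in order of magnitude.\<close>

lemma image_dimension_bound:
  fixes f :: "'a::metric_space \<Rightarrow> 'b::metric_space"
  assumes d: "0 \<le> d" and \<beta>: "0 < \<beta>" and p: "0 < p" and r0: "0 < r0" and C: "0 \<le> C"
    and cov: "\<forall>\<^sub>F r in at_right 0. \<exists>n. covering_number E r = enat n \<and> real n \<le> r powr (-d)"
    and bad: "\<And>S r s. S \<subseteq> E \<Longrightarrow> 0 < r \<Longrightarrow> r < r0 \<Longrightarrow> 0 < s \<Longrightarrow> separated (r / 2) S \<Longrightarrow>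
       (\<And>x. x \<in> S \<Longrightarrow> \<exists>y\<in>ball x r. \<exists>w\<in>ball x r. s < dist (f y) (f w)) \<Longrightarrow>
       real (card S) \<le> C * r powr \<beta> * s powr (-p)"
    and fine: "\<And>s. 0 < s \<Longrightarrow> \<exists>\<delta>>0. \<forall>x\<in>E. \<forall>y\<in>ball x \<delta>. \<forall>w\<in>ball x \<delta>. dist (f y) (f w) \<le> s"
  shows "minkowski_dim (f ` E) \<le> ereal (p * d / (\<beta> + d))"
proof -
  define \<tau> where "\<tau> = p / (\<beta> + d)"
  define t where "t = p * d / (\<beta> + d)"
  define \<theta> where "\<theta> = 2 powr (-\<beta>)"
  have \<tau>: "0 < \<tau>" "\<tau> * d = t" "\<tau> * \<beta> - p = -t"
    using p d \<beta> by (auto simp: \<tau>_def t_def field_simps)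
  have \<theta>: "0 < \<theta>" "\<theta> < 1" using \<beta> by (auto simp: \<theta>_def powr_less_one)
  define A where "A = 2 powr d + C / (1 - \<theta>)"
  have "2 powr 0 \<le> (2::real) powr d" using d by (intro powr_mono) auto
  then have A: "1 \<le> A" unfolding A_def using C \<theta> by (intro add_increasing2) auto
  obtain r1 where r1: "0 < r1"
    "\<And>r. 0 < r \<Longrightarrow> r < r1 \<Longrightarrow> \<exists>n. covering_number E r = enat n \<and> real n \<le> r powr (-d)"
    using cov unfolding eventually_at_right_field by auto
  have count: "\<exists>n. covering_number (f ` E) s \<le> enat n \<and> real n \<le> A * s powr (-t)"
    if s: "0 < s" "s < min r0 r1 powr (1 / \<tau>)" for s
  proof -
    define \<rho> where "\<rho> = s powr \<tau>"
    have "s powr \<tau> < (min r0 r1 powr (1 / \<tau>)) powr \<tau>"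
      using s \<tau> by (intro powr_less_mono2) auto
    then have \<rho>: "0 < \<rho>" "\<rho> < r0" "\<rho> < r1"
      using s \<tau> r0 r1 by (auto simp: \<rho>_def powr_powr)
    have scale: "\<rho> / 2 ^ k \<le> \<rho>" for k
      using \<rho> mult_left_mono[of 1 "2 ^ k" \<rho>] by (simp add: divide_le_eq)
    obtain \<delta> where \<delta>: "0 < \<delta>" "\<And>x y w. x \<in> E \<Longrightarrow> y \<in> ball x \<delta> \<Longrightarrow> w \<in> ball x \<delta> \<Longrightarrow> dist (f y) (f w) \<le> s"
      using fine[OF s(1)] by blast
    have "(\<lambda>k. \<rho> / 2 ^ k) \<longlonglongrightarrow> 0" by (rule LIMSEQ_divide_realpow_zero) simp
    then have "\<forall>\<^sub>F k in sequentially. \<rho> / 2 ^ k < \<delta>" using \<delta>(1) by (rule order_tendstoD)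
    then obtain m where m: "\<rho> / 2 ^ m < \<delta>" using eventually_happens by fastforce
    have "\<exists>n. covering_number (f ` E) s \<le> enat n \<and>
        real n \<le> 2 powr d * s powr (-t) + (C * s powr (-t)) / (1 - \<theta>)"
    proof (rule multiscale_covering[where \<rho> = \<rho> and m = m])
      fix S assume S: "S \<subseteq> E" "separated \<rho> S"
      obtain n where n: "covering_number E (\<rho> / 2) = enat n" "real n \<le> (\<rho> / 2) powr (-d)"
        using r1(2)[of "\<rho> / 2"] \<rho> by auto
      have "card S \<le> n" using separated_card_le_covering_number[OF S _ n(1)] \<rho> by simp
      then have "real (card S) \<le> (\<rho> / 2) powr (-d)" using n(2) by linarith
      also have "\<dots> = 2 powr d * s powr (-t)"
        using s \<tau>(2) by (simp add: \<rho>_def powr_divide powr_powr powr_minus_divide)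
      finally show "real (card S) \<le> 2 powr d * s powr (-t)" .
    next
      fix S k
      assume S: "S \<subseteq> E" "separated (\<rho> / 2 ^ Suc k) S"
        and big: "\<And>x. x \<in> S \<Longrightarrow> \<exists>y\<in>ball x (\<rho> / 2 ^ k). \<exists>w\<in>ball x (\<rho> / 2 ^ k). s < dist (f y) (f w)"
      have "real (card S) \<le> C * (\<rho> / 2 ^ k) powr \<beta> * s powr (-p)"
        using S \<rho> scale[of k] s big by (intro bad) (auto simp: mult.commute)
      also have "(\<rho> / 2 ^ k) powr \<beta> = \<rho> powr \<beta> * \<theta> ^ k"
        using \<rho> by (simp add: \<theta>_def powr_divide powr_minus_divide powr_realpow[symmetric]
          powr_powr power_one_over[symmetric] mult.commute power_divide)
      also have "C * (\<rho> powr \<beta> * \<theta> ^ k) * s powr (-p) = C * (s powr (\<tau> * \<beta>) * s powr (-p)) * \<theta> ^ k"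
        by (simp add: \<rho>_def powr_powr)
      also have "s powr (\<tau> * \<beta>) * s powr (-p) = s powr (-t)"
        using \<tau>(3) by (simp add: powr_add[symmetric])
      finally show "real (card S) \<le> C * s powr (-t) * \<theta> ^ k" .
    next
      fix x y w assume "x \<in> E" "y \<in> ball x (\<rho> / 2 ^ m)" "w \<in> ball x (\<rho> / 2 ^ m)"
      then show "dist (f y) (f w) \<le> s" using m by (intro \<delta>(2)) auto
    qed (use \<rho> s C \<theta> in auto)
    then show ?thesis by (simp add: A_def algebra_simps)
  qed
  have "\<forall>\<^sub>F s in at_right 0. \<exists>n. covering_number (f ` E) s \<le> enat n \<and> real n \<le> A * s powr (-t)"
    unfolding eventually_at_right_field
    using count r0 r1 by (intro exI[of _ "min r0 r1 powr (1 / \<tau>)"]) auto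
  then have "minkowski_dim (f ` E) \<le> ereal t"
    using p d \<beta> by (intro minkowski_dim_le_if_covering[OF A]) (auto simp: t_def)
  then show ?thesis by (simp add: t_def)
qed

text \<open>Each of the balls has Hoelder coefficient at least \<open>s\<close> divided by \<open>2 * r\<close> to the power \<open>1 - Q/p\<close>,
hence contributes at least \<open>s\<^sup>p\<close> divided by \<open>2 * r\<close> to the power \<open>p - Q\<close> to the sum.\<close>

lemma oscillating_balls_count:
  fixes f :: "'a::metric_space \<Rightarrow> 'b::metric_space"
  assumes Q: "0 < Q" "Q < p" and C: "0 < C" and r: "0 < r" and s: "0 < s"
    and sum: "(\<Sum>x\<in>S. ennpowr (holder_coeff (1 - Q / p) (ball x r) f) p) \<le> ennreal C"
    and big: "\<And>x. x \<in> S \<Longrightarrow> \<exists>y\<in>ball x r. \<exists>w\<in>ball x r. s < dist (f y) (f w)"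
  shows "real (card S) \<le> C * 2 powr (p - Q) * r powr (p - Q) * s powr (-p)"
proof -
  define \<alpha> where "\<alpha> = 1 - Q / p"
  have \<alpha>: "0 < \<alpha>" "\<alpha> * p = p - Q" using Q by (auto simp: \<alpha>_def field_simps)
  define h where "h = s powr p / (2 * r) powr (p - Q)"
  have h: "0 < h" using r s by (simp add: h_def)
  have each: "ennreal h \<le> ennpowr (holder_coeff (1 - Q / p) (ball x r) f) p" if x: "x \<in> S" for x
  proof -
    obtain y w where yw: "y \<in> ball x r" "w \<in> ball x r" "s < dist (f y) (f w)"
      using big[OF x] by blast
    then have ne: "y \<noteq> w" using s by auto
    have "dist y w < 2 * r" using yw dist_triangle3[of y w x] by simp
    then have "dist y w powr \<alpha> \<le> (2 * r) powr \<alpha>" using \<alpha> by (intro powr_mono2) auto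
    then have "s / (2 * r) powr \<alpha> \<le> dist (f y) (f w) / dist y w powr \<alpha>"
      using yw s ne by (intro frac_le) auto
    then have "ennreal (s / (2 * r) powr \<alpha>) \<le> ennreal (dist (f y) (f w) / dist y w powr \<alpha>)"
      by (rule ennreal_leI)
    also have "\<dots> \<le> holder_coeff \<alpha> (ball x r) f"
      unfolding holder_coeff_def using yw ne by (intro SUP_upper2[of "(y, w)"]) auto
    finally have "ennpowr (ennreal (s / (2 * r) powr \<alpha>)) p \<le> ennpowr (holder_coeff \<alpha> (ball x r) f) p"
      using Q by (intro ennpowr_mono) auto
    moreover have "ennpowr (ennreal (s / (2 * r) powr \<alpha>)) p = ennreal h"
      using s r \<alpha>(2) by (simp add: ennpowr_ennreal powr_divide powr_powr h_def)
    ultimately show ?thesis by (simp add: \<alpha>_def)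
  qed
  have "ennreal (real (card S) * h) = (\<Sum>x\<in>S. ennreal h)"
    using h by (simp add: ennreal_mult flip: ennreal_of_nat_eq_real_of_nat)
  also have "\<dots> \<le> (\<Sum>x\<in>S. ennpowr (holder_coeff (1 - Q / p) (ball x r) f) p)"
    by (rule sum_mono) (rule each)
  also note sum
  finally have "real (card S) * h \<le> C" using C by (simp add: ennreal_le_iff)
  then have "real (card S) \<le> C / h" using h by (simp add: pos_le_divide_eq)
  also have "C / h = C * 2 powr (p - Q) * r powr (p - Q) * s powr (-p)"
    using r s by (simp add: h_def powr_mult powr_minus_divide)
  finally show ?thesis .
qed

lemma uniform_small_images:
  fixes f :: "'a::metric_space \<Rightarrow> 'b::metric_space" and E :: "'a set"
  assumes proper: "\<forall>S :: 'a set. closed S \<and> bounded S \<longrightarrow> compact S"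
    and f: "continuous_on UNIV f" and E: "bounded E" and s: "0 < s"
  shows "\<exists>\<delta>>0. \<forall>x\<in>E. \<forall>y\<in>ball x \<delta>. \<forall>w\<in>ball x \<delta>. dist (f y) (f w) \<le> s"
proof -
  obtain a \<rho> where \<rho>: "E \<subseteq> cball a \<rho>" using E by (meson bounded_subset_cball)
  have "uniformly_continuous_on (cball a (\<rho> + 1)) f"
    using proper by (intro compact_uniformly_continuous continuous_on_subset[OF f]) auto
  then obtain \<delta> where \<delta>: "0 < \<delta>" "\<And>y w. y \<in> cball a (\<rho> + 1) \<Longrightarrow> w \<in> cball a (\<rho> + 1) \<Longrightarrow>
      dist w y < \<delta> \<Longrightarrow> dist (f w) (f y) < s"
    using s unfolding uniformly_continuous_on_def by meson
  show ?thesis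
  proof (intro exI[of _ "min (\<delta> / 2) 1"] conjI ballI)
    fix x y w assume x: "x \<in> E" and y: "y \<in> ball x (min (\<delta> / 2) 1)" and w: "w \<in> ball x (min (\<delta> / 2) 1)"
    have ax: "dist a x \<le> \<rho>" using x \<rho> by auto
    have "dist y w < \<delta>" using y w dist_triangle3[of y w x] by simp
    moreover have "y \<in> cball a (\<rho> + 1)" "w \<in> cball a (\<rho> + 1)"
      using ax y w dist_triangle[of a y x] dist_triangle[of a w x] by auto
    ultimately show "dist (f y) (f w) \<le> s" using \<delta>(2) by (intro less_imp_le) auto
  qed (use \<delta> in auto)
qed

theorem theorem1p2:
  fixes M :: "'a::metric_space measure"
    and f :: "'a \<Rightarrow> 'b::metric_space"
    and g :: "'a \<Rightarrow> ennreal"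
    and Q p :: real
  assumes "Q > 0"
    and "metric_measure_space M"
    and "\<forall>S :: 'a set. closed S \<and> bounded S \<longrightarrow> compact S"
    and "locally_homogeneous Q M"
    and "poincare_inequality Q M"
    and "p > Q"
    and "continuous_on UNIV f"
    and "upper_gradient f g"
    and "Lp_loc p M g"
  shows "(\<forall>q. Q < q \<and> q < p \<longrightarrow> compactly_holder q (1 - Q / q) f) \<and>
    (\<forall>(E :: 'a set) dE :: real.
       bounded E \<longrightarrow> minkowski_dim E = ereal dE \<longrightarrow> dE < Q \<longrightarrow>
       minkowski_dim (f ` E) \<le> ereal (p * dE / (p - Q + dE)) \<and>
       p * dE / (p - Q + dE) < Q)"
proof (intro conjI allI impI)
  fix q assume q: "Q < q \<and> q < p"
  show "compactly_holder q (1 - Q / q) f"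
  proof (rule compactly_holder_if_sums_bounded)
    fix A :: "'a set" and \<epsilon> :: real assume A: "bounded A" "0 < \<epsilon>" "\<epsilon> < 1"
    show "\<exists>r0>0. \<exists>C>0. \<forall>(S :: nat set) z r.
      finite S \<longrightarrow> z ` S \<subseteq> A \<longrightarrow> 0 < r \<longrightarrow> r < r0 \<longrightarrow>
      (\<forall>i\<in>S. \<forall>j\<in>S. i \<noteq> j \<longrightarrow> ball (z i) (\<epsilon> * r) \<inter> ball (z j) (\<epsilon> * r) = {}) \<longrightarrow>
      (\<Sum>i\<in>S. ennpowr (holder_coeff (1 - Q / q) (ball (z i) r) f) q) \<le> ennreal C"
      using q by (intro holder_sum_bounded[OF assms(1-5,7-9) _ _ A(2,3,1)]) auto
  qed
next
  fix E :: "'a set" and dE :: real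
  assume E: "bounded E" "minkowski_dim E = ereal dE" "dE < Q"
  have dE: "0 \<le> dE" using minkowski_dim_nonneg[of E] E(2) by simp
  \<comment> \<open>A net at level \<open>k + 1\<close> is separated by half the radius \<open>r\<close> of the oscillating balls, so the balls of radius \<open>r / 4\<close> around its points are disjoint.\<close>
  have quarter: "0 < (1 / 4 :: real)" "(1 / 4 :: real) < 1" by simp_all
  obtain r0 C where r0: "0 < r0" "0 < C" and sums: "\<And>(S :: 'a set) z r.
      finite S \<Longrightarrow> z ` S \<subseteq> E \<Longrightarrow> 0 < r \<Longrightarrow> r < r0 \<Longrightarrow>
      \<forall>i\<in>S. \<forall>j\<in>S. i \<noteq> j \<longrightarrow> ball (z i) (1 / 4 * r) \<inter> ball (z j) (1 / 4 * r) = {} \<Longrightarrow>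
      (\<Sum>i\<in>S. ennpowr (holder_coeff (1 - Q / p) (ball (z i) r) f) p) \<le> ennreal C"
    using holder_sum_bounded[OF assms(1-5,7-9,6) order_refl quarter E(1)] by blast
  have bad: "real (card S) \<le> C * 2 powr (p - Q) * r powr (p - Q) * s powr (-p)"
    if S: "S \<subseteq> E" and r: "0 < r" "r < r0" and s: "0 < s" and sep: "separated (r / 2) S"
      and big: "\<And>x. x \<in> S \<Longrightarrow> \<exists>y\<in>ball x r. \<exists>w\<in>ball x r. s < dist (f y) (f w)" for S r s
  proof (rule oscillating_balls_count[OF assms(1,6) r0(2) r(1) s _ big])
    show "(\<Sum>x\<in>S. ennpowr (holder_coeff (1 - Q / p) (ball x r) f) p) \<le> ennreal C"
    proof (rule sums)
      have "ball x (1 / 4 * r) \<inter> ball y (1 / 4 * r) = {}" if "x \<in> S" "y \<in> S" "x \<noteq> y" for x y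
        using that sep by (intro disjoint_ballI) (auto simp: separated_def)
      then show "\<forall>x\<in>S. \<forall>y\<in>S. x \<noteq> y \<longrightarrow> ball x (1 / 4 * r) \<inter> ball y (1 / 4 * r) = {}"
        by blast
    qed (use S r sep in \<open>auto simp: separated_def\<close>)
  qed
  have le: "minkowski_dim (f ` E) \<le> ereal (p * d / (p - Q + d))" if "dE < d" for d
  proof (rule image_dimension_bound[OF _ _ _ r0(1) _ minkowski_dim_less_imp_covering bad])
    show "\<exists>\<delta>>0. \<forall>x\<in>E. \<forall>y\<in>ball x \<delta>. \<forall>w\<in>ball x \<delta>. dist (f y) (f w) \<le> s" if "0 < s" for s
      using uniform_small_images[OF assms(3,7) E(1) that] .
  qed (use that dE assms(1,6) r0 E in auto)
  show "minkowski_dim (f ` E) \<le> ereal (p * dE / (p - Q + dE))"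
  proof (rule tendsto_lowerbound)
    show "((\<lambda>d. ereal (p * d / (p - Q + d))) \<longlongrightarrow> ereal (p * dE / (p - Q + dE))) (at_right dE)"
      using dE assms(6) by (intro tendsto_intros) auto
    show "\<forall>\<^sub>F d in at_right dE. minkowski_dim (f ` E) \<le> ereal (p * d / (p - Q + d))"
      using le by (auto simp: eventually_at_right_field intro: exI[of _ "dE + 1"])
  qed (simp add: trivial_limit_at_right_real)
  have "dE * (p - Q) < Q * (p - Q)" using E(3) assms(6) by simp
  then show "p * dE / (p - Q + dE) < Q"
    using dE assms(6) by (simp add: divide_less_eq algebra_simps)
qed

end
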